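(* Let $G=(V,E)$ be a graph without isolated vertices and suppose that $G$ is fully reconstructible in $\mathbb{C}^d$. Then $G$ is $M$-connected in $\mathbb{R}^d$.
   Context: Graphs are finite and simple. For $p:V\to\mathbb{C}^d$, the complex squared length of edge $uv$ is $m_{uv}(p)=\sum_{k=1}^d(p(u)_k-p(v)_k)^2$. A framework is generic if its coordinates are algebraically independent over $\mathbb{Q}$. $(G,p),(H,q)$ are length-equivalent under a bijection $\psi:E(G)\to E(H)$ if $m_e(p)=m_{\psi(e)}(q)$ for all $e\in E(G)$. A generic $(G,p)$ in $\mathbb{C}^d$ ($G$ without isolated vertices) is fully reconstructible if for every graph $H$ without isolated vertices and every generic $(H,q)$ in $\mathbb{C}^d$ length-equivalent to $(G,p)$ under some $\psi$, there is an isomorphism $\varphi:V(G)\to V(H)$ with $\psi(uv)=\varphi(u)\varphi(v)$ for all edges $uv$; $G$ is fully reconstructible in $\mathbb{C}^d$ if every generic realization in $\mathbb{C}^d$ is. The rigidity matrix $R(G,p)$ is the $|E|\times d|V|$ matrix whose row for $uv$ has $p(u)-p(v)$ in the columns of $u$, $p(v)-p(u)$ in the columns of $v$, zeros elsewhere; the $d$-dimensional rigidity matroid $\mathcal{R}_d(G)$ on $E$ is given by row independence of $R(G,p)$ for generic $p\in\mathbb{R}^{d|V|}$. $G$ is $M$-connected in $\mathbb{R}^d$ if $\mathcal{R}_d(G)$ is a connected matroid (any two distinct elements lie in a common circuit). *)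

theory Defs
  imports Complex_Main
begin

definition simple_graph :: "'v set \<Rightarrow> 'v set set \<Rightarrow> bool" where
  "simple_graph V E \<longleftrightarrow> finite V \<and> (\<forall>e\<in>E. e \<subseteq> V \<and> card e = 2)"

definition no_isolated :: "'v set \<Rightarrow> 'v set set \<Rightarrow> bool" where
  "no_isolated V E \<longleftrightarrow> (\<forall>v\<in>V. \<exists>e\<in>E. v \<in> e)"

text \<open>The family x indexed by the finite set I is algebraically independent over Q:
no nonzero rational polynomial in the variables indexed by I vanishes at x.
A polynomial is a finite set M of distinct monomials (exponent vectors supported on I)
with rational coefficients c.\<close>

definition alg_indep :: "'i set \<Rightarrow> ('i \<Rightarrow> 'a::field_char_0) \<Rightarrow> bool" where
  "alg_indep I x \<longleftrightarrow>
     (\<forall>(M :: ('i \<Rightarrow> nat) set) (c :: ('i \<Rightarrow> nat) \<Rightarrow> rat).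
        finite M \<and> (\<forall>m\<in>M. \<forall>i. i \<notin> I \<longrightarrow> m i = 0) \<and>
        (\<Sum>m\<in>M. of_rat (c m) * (\<Prod>i\<in>I. x i ^ m i)) = 0
        \<longrightarrow> (\<forall>m\<in>M. c m = 0))"

definition generic :: "nat \<Rightarrow> 'v set \<Rightarrow> ('v \<Rightarrow> nat \<Rightarrow> 'a::field_char_0) \<Rightarrow> bool" where
  "generic d V p \<longleftrightarrow> alg_indep (V \<times> {..<d}) (\<lambda>(v, k). p v k)"

definition sqlen :: "nat \<Rightarrow> ('v \<Rightarrow> nat \<Rightarrow> complex) \<Rightarrow> 'v \<Rightarrow> 'v \<Rightarrow> complex" where
  "sqlen d p u v = (\<Sum>k<d. (p u k - p v k)^2)"

definition length_equiv ::
  "nat \<Rightarrow> 'v set set \<Rightarrow> ('v \<Rightarrow> nat \<Rightarrow> complex) \<Rightarrow> 'w set set \<Rightarrow> ('w \<Rightarrow> nat \<Rightarrow> complex)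
     \<Rightarrow> ('v set \<Rightarrow> 'w set) \<Rightarrow> bool" where
  "length_equiv d E p F q \<psi> \<longleftrightarrow>
     bij_betw \<psi> E F \<and>
     (\<forall>u v. {u, v} \<in> E \<longrightarrow> (\<forall>a b. \<psi> {u, v} = {a, b} \<longrightarrow> sqlen d p u v = sqlen d q a b))"

text \<open>Competing graphs H are taken on vertex type nat (every finite graph is isomorphic
to one on nat, and all notions involved are invariant under relabelling). H has no
isolated vertices, so its vertex set is the union of its edges.\<close>

definition fully_reconstructible_fw ::
  "nat \<Rightarrow> 'v set \<Rightarrow> 'v set set \<Rightarrow> ('v \<Rightarrow> nat \<Rightarrow> complex) \<Rightarrow> bool" where
  "fully_reconstructible_fw d V E p \<longleftrightarrow>
     (\<forall>(F :: nat set set) (q :: nat \<Rightarrow> nat \<Rightarrow> complex) (\<psi> :: 'v set \<Rightarrow> nat set).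
        simple_graph (\<Union>F) F \<and> generic d (\<Union>F) q \<and> length_equiv d E p F q \<psi>
        \<longrightarrow> (\<exists>\<phi>. bij_betw \<phi> V (\<Union>F) \<and>
                 (\<forall>u v. {u, v} \<in> E \<longrightarrow> \<psi> {u, v} = {\<phi> u, \<phi> v})))"

definition fully_reconstructible :: "nat \<Rightarrow> 'v set \<Rightarrow> 'v set set \<Rightarrow> bool" where
  "fully_reconstructible d V E \<longleftrightarrow>
     (\<forall>p. generic d V p \<longrightarrow> fully_reconstructible_fw d V E p)"

text \<open>Entry of the rigidity matrix R(G,p) in row e = {u,v} and column (w,k):
p(u)_k - p(v)_k if w = u, p(v)_k - p(u)_k if w = v, and 0 otherwise.\<close>

definition rig_entry :: "('v \<Rightarrow> nat \<Rightarrow> real) \<Rightarrow> 'v set \<Rightarrow> 'v \<Rightarrow> nat \<Rightarrow> real" where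
  "rig_entry p e w k = (if w \<in> e then p w k - p (the_elem (e - {w})) k else 0)"

definition rows_indep :: "nat \<Rightarrow> 'v set \<Rightarrow> ('v \<Rightarrow> nat \<Rightarrow> real) \<Rightarrow> 'v set set \<Rightarrow> bool" where
  "rows_indep d V p S \<longleftrightarrow>
     (\<forall>c :: 'v set \<Rightarrow> real.
        (\<forall>w\<in>V. \<forall>k<d. (\<Sum>e\<in>S. c e * rig_entry p e w k) = 0) \<longrightarrow> (\<forall>e\<in>S. c e = 0))"

text \<open>Independence in R_d(G): row independence in R(G,p) for a generic real p
(this does not depend on the choice of generic p).\<close>

definition rig_indep :: "nat \<Rightarrow> 'v set \<Rightarrow> 'v set set \<Rightarrow> bool" where
  "rig_indep d V S \<longleftrightarrow> (\<exists>p :: 'v \<Rightarrow> nat \<Rightarrow> real. generic d V p \<and> rows_indep d V p S)"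

definition rig_circuit :: "nat \<Rightarrow> 'v set \<Rightarrow> 'v set set \<Rightarrow> 'v set set \<Rightarrow> bool" where
  "rig_circuit d V E C \<longleftrightarrow>
     C \<subseteq> E \<and> \<not> rig_indep d V C \<and> (\<forall>D. D \<subset> C \<longrightarrow> rig_indep d V D)"

definition M_connected :: "nat \<Rightarrow> 'v set \<Rightarrow> 'v set set \<Rightarrow> bool" where
  "M_connected d V E \<longleftrightarrow>
     (\<forall>e\<in>E. \<forall>f\<in>E. e \<noteq> f \<longrightarrow> (\<exists>C. rig_circuit d V E C \<and> e \<in> C \<and> f \<in> C))"

end

theory Submission
  imports Defs "HOL-Analysis.Finite_Cartesian_Product" "HOL-Analysis.Continuum_Not_Denumerable"
    "HOL-Computational_Algebra.Polynomial"
begin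

text \<open>If \<open>G\<close> is not M-connected, its edge set splits into two parts such that every stress of a
  generic realization restricts to a stress of each part. When the parts share a vertex, the
  competitor \<open>H\<close> consists of disjoint copies of the two parts; otherwise the parts are glued at a
  vertex. It remains to find generic \<open>p\<close> and \<open>q\<close> with equal edge lengths, and real ones exist: for
  disjoint copies, squared lengths at \<open>x + h\<close> and \<open>x - h\<close> agree iff \<open>h\<close> is an infinitesimal flex of
  \<open>x\<close>, and since the generic ranks of \<open>G\<close> and \<open>H\<close> agree, the linear system for a flex that makes
  \<open>x - h\<close> factor through \<open>G\<close> is solvable by rational functions.\<close>

section \<open>Polynomial functions\<close>

text \<open>An isomorphism inducing \<open>\<psi>\<close> preserves whether two edges meet, and each
  competitor violates this: splitting makes two meeting edges disjoint, gluing makes two disjoint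
  edges meet. The obstacle is that \<open>p\<close> and \<open>q\<close> must both be algebraically
  independent while having equal lengths. Near a configuration that doubles a generic
  \<open>x\<^sub>0\<close>, the implicit function theorem would produce \<open>p\<close> from
  \<open>q\<close>, but only as an analytic function. Working from the midpoint makes the condition
  linear in \<open>h\<close>, so both frameworks become rational functions of one real parameter. A
  polynomial that is nonzero at one point of such a curve vanishes at only finitely many parameters,
  and there are only countably many rational polynomials, so all but countably many parameters make
  both frameworks generic.\<close>

inductive polyfun :: "'i set \<Rightarrow> (('i \<Rightarrow> real) \<Rightarrow> real) \<Rightarrow> bool" for I where
  polyfun_const: "polyfun I (\<lambda>_. a)"
| polyfun_coord: "i \<in> I \<Longrightarrow> polyfun I (\<lambda>x. x i)"
| polyfun_add: "polyfun I f \<Longrightarrow> polyfun I g \<Longrightarrow> polyfun I (\<lambda>x. f x + g x)"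
| polyfun_mult: "polyfun I f \<Longrightarrow> polyfun I g \<Longrightarrow> polyfun I (\<lambda>x. f x * g x)"

lemma polyfun_diff:
  assumes "polyfun I f" "polyfun I g"
  shows "polyfun I (\<lambda>x. f x - g x)"
  using polyfun_add[OF assms(1) polyfun_mult[OF polyfun_const[of _ "-1"] assms(2)]] by simp

lemma polyfun_sum:
  "(\<And>a. a \<in> A \<Longrightarrow> polyfun I (f a)) \<Longrightarrow> polyfun I (\<lambda>x. \<Sum>a\<in>A. f a x)"
  by (induction A rule: infinite_finite_induct) (auto intro: polyfun_const polyfun_add)

lemma polyfun_power: "polyfun I f \<Longrightarrow> polyfun I (\<lambda>x. f x ^ n)"
  by (induction n) (auto intro: polyfun_const polyfun_mult)

lemma polyfun_prod:
  "(\<And>a. a \<in> A \<Longrightarrow> polyfun I (f a)) \<Longrightarrow> polyfun I (\<lambda>x. \<Prod>a\<in>A. f a x)"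
  by (induction A rule: infinite_finite_induct) (auto intro: polyfun_const polyfun_mult)

lemma polyfun_cong:
  assumes "polyfun I f" "\<And>i. i \<in> I \<Longrightarrow> x i = y i"
  shows "f x = f y"
  using assms by (induction rule: polyfun.induct) auto

lemma polyfun_compose:
  assumes "polyfun J f" "\<And>j. j \<in> J \<Longrightarrow> polyfun I (\<lambda>x. g x j)"
  shows "polyfun I (\<lambda>x. f (g x))"
  using assms by (induction rule: polyfun.induct) (auto intro: polyfun.intros)

lemma polyfun_tendsto:
  assumes "polyfun I f" "\<And>i. i \<in> I \<Longrightarrow> ((\<lambda>t. w t i) \<longlongrightarrow> z i) F"
  shows "((\<lambda>t. f (w t)) \<longlongrightarrow> f z) F"
  using assms by (induction rule: polyfun.induct) (auto intro: tendsto_intros)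

section \<open>Polynomial functions along rational curves\<close>

lemma polyfun_clear_denominators:
  fixes w :: "real \<Rightarrow> 'i \<Rightarrow> real"
  assumes "polyfun I f"
    and "\<And>i t. i \<in> I \<Longrightarrow> poly D t \<noteq> 0 \<Longrightarrow> w t i * poly D t = poly (N i) t"
  shows "\<exists>n P. \<forall>t. poly D t \<noteq> 0 \<longrightarrow> f (w t) * poly D t ^ n = poly P t"
  using assms
proof (induction rule: polyfun.induct)
  case (polyfun_const a)
  show ?case by (intro exI[of _ 0] exI[of _ "[:a:]"]) simp
next
  case (polyfun_coord i)
  then show ?case by (intro exI[of _ 1] exI[of _ "N i"]) simp
next
  case (polyfun_add f g)
  then obtain m P n Q where
    "\<forall>t. poly D t \<noteq> 0 \<longrightarrow> f (w t) * poly D t ^ m = poly P t"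
    "\<forall>t. poly D t \<noteq> 0 \<longrightarrow> g (w t) * poly D t ^ n = poly Q t"
    by blast
  then have "\<forall>t. poly D t \<noteq> 0 \<longrightarrow>
      (f (w t) + g (w t)) * poly D t ^ (m + n) = poly (P * D ^ n + Q * D ^ m) t"
    by (simp add: power_add algebra_simps flip: poly_power)
  then show ?case by blast
next
  case (polyfun_mult f g)
  then obtain m P n Q where
    "\<forall>t. poly D t \<noteq> 0 \<longrightarrow> f (w t) * poly D t ^ m = poly P t"
    "\<forall>t. poly D t \<noteq> 0 \<longrightarrow> g (w t) * poly D t ^ n = poly Q t"
    by blast
  then have "\<forall>t. poly D t \<noteq> 0 \<longrightarrow>
      (f (w t) * g (w t)) * poly D t ^ (m + n) = poly (P * Q) t"
    by (simp add: power_add algebra_simps) 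
  then show ?case by blast
qed

lemma polyfun_along_poly_curve:
  assumes "polyfun I f" "\<And>i t. i \<in> I \<Longrightarrow> w t i = poly (N i) t"
  shows "\<exists>P. \<forall>t. f (w t) = poly P t"
  using polyfun_clear_denominators[OF assms(1), of 1 w N] assms(2) by simp

text \<open>One parameter \<open>s\<close> with a nonzero value shows that the numerator left after
  clearing denominators is a nonzero polynomial in \<open>t\<close>, which has finitely many roots.
  The choice of generic points rests on this.\<close>

lemma finite_zeros_along_rational_curve:
  fixes w :: "real \<Rightarrow> 'i \<Rightarrow> real"
  assumes f: "polyfun I f"
    and w: "\<And>i t. i \<in> I \<Longrightarrow> poly D t \<noteq> 0 \<Longrightarrow> w t i * poly D t = poly (N i) t"
    and s: "poly D s \<noteq> 0" "f (w s) \<noteq> 0"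
  shows "finite {t. poly D t \<noteq> 0 \<and> f (w t) = 0}"
proof -
  obtain n P where P: "\<And>t. poly D t \<noteq> 0 \<Longrightarrow> f (w t) * poly D t ^ n = poly P t"
    using polyfun_clear_denominators[of I f D w N, OF f w] by blast
  have "poly P s \<noteq> 0" using P[OF s(1)] s by (metis mult_eq_0_iff power_not_zero)
  then have "finite {t. poly P t = 0}" by (intro poly_roots_finite) auto
  moreover have "{t. poly D t \<noteq> 0 \<and> f (w t) = 0} \<subseteq> {t. poly P t = 0}"
    using P by fastforce
  ultimately show ?thesis by (rule rev_finite_subset)
qed

section \<open>Avoiding countably many zero sets\<close>

lemma ex_real_avoiding_countable:
  assumes "countable A" "\<And>a. a \<in> A \<Longrightarrow> countable (Z a)"
  shows "\<exists>t::real. \<forall>a\<in>A. t \<notin> Z a"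
proof -
  have "countable (\<Union>a\<in>A. Z a)" using assms by (rule countable_UN)
  then have "(\<Union>a\<in>A. Z a) \<noteq> UNIV" using uncountable_UNIV_real by metis
  then show ?thesis by blast
qed

text \<open>One coordinate at a time: freeze the last coordinate to a value at which the given
  polynomial function does not vanish identically, choose the other coordinates by induction,
  and then move the last coordinate off the countably many zeros.\<close>

lemma ex_common_nonzero:
  fixes \<F> :: "(('i \<Rightarrow> real) \<Rightarrow> real) set"
  assumes "finite I" "countable \<F>"
    and "\<And>f. f \<in> \<F> \<Longrightarrow> polyfun I f" "\<And>f. f \<in> \<F> \<Longrightarrow> \<exists>x. f x \<noteq> 0"
  shows "\<exists>x. \<forall>f\<in>\<F>. f x \<noteq> 0"
  using assms
proof (induction I arbitrary: \<F> rule: finite_induct)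
  case empty
  then have "f x \<noteq> 0" if "f \<in> \<F>" for f x
    using that polyfun_cong[of "{}" f] by (metis empty_iff)
  then show ?case by blast
next
  case (insert i I)
  obtain X where X: "\<And>f. f \<in> \<F> \<Longrightarrow> f (X f) \<noteq> 0" using insert.prems(3) by metis
  define r where "r f = (\<lambda>x. f (x(i := X f i)))" for f
  have "\<exists>x. \<forall>g \<in> r ` \<F>. g x \<noteq> 0"
  proof (rule insert.IH)
    show "countable (r ` \<F>)" using insert.prems by simp
  next
    fix g assume "g \<in> r ` \<F>"
    then obtain f where f: "f \<in> \<F>" "g = r f" by blast
    show "polyfun I g" unfolding f(2) r_def
    proof (rule polyfun_compose[OF insert.prems(2)[OF f(1)]])
      fix j assume "j \<in> insert i I"
      then show "polyfun I (\<lambda>x. (x(i := X f i)) j)"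
        by (cases "j = i") (auto intro: polyfun.intros)
    qed
    show "\<exists>x. g x \<noteq> 0" using X[OF f(1)] unfolding f(2) r_def by (metis fun_upd_triv)
  qed
  then obtain x where "\<And>g. g \<in> r ` \<F> \<Longrightarrow> g x \<noteq> 0" by blast
  then have x: "f (x(i := X f i)) \<noteq> 0" if "f \<in> \<F>" for f
    using that unfolding r_def by blast
  have "countable {t. f (x(i := t)) = 0}" if f: "f \<in> \<F>" for f
  proof -
    have "finite {t. poly 1 t \<noteq> (0::real) \<and> f (x(i := t)) = 0}"
    proof (rule finite_zeros_along_rational_curve[OF insert.prems(2)[OF f], where s = "X f i"])
      show "(x(i := t)) j * poly 1 t = poly (if j = i then [:0, 1:] else [:x j:]) t" for j t
        by simp
    qed (use x[OF f] in \<open>auto simp del: fun_upd_apply\<close>)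
    then show ?thesis by (simp add: countable_finite)
  qed
  from ex_real_avoiding_countable[OF insert.prems(1), of "\<lambda>f. {t. f (x(i := t)) = 0}", OF this]
  obtain t where "\<forall>f\<in>\<F>. f (x(i := t)) \<noteq> 0" by blast
  then show ?case by blast
qed

text \<open>The base point \<open>a\<close> is fixed and the direction \<open>w\<close> varies. The
  degree bound is uniform in \<open>w\<close> and the coefficients are polynomial in
  \<open>w\<close>, because later the direction itself depends on \<open>t\<close> and the
  coefficients have to converge with it.\<close>

lemma polyfun_expand_along_rays:
  assumes "polyfun I f"
  shows "\<exists>P n. (\<forall>w t. f (\<lambda>i. a i + t * w i) = poly (P w) t) \<and>
    (\<forall>w. degree (P w) \<le> n) \<and> (\<forall>j. polyfun I (\<lambda>w. coeff (P w) j))"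
  using assms
proof (induction rule: polyfun.induct)
  case (polyfun_const c)
  show ?case
    by (rule exI[of _ "\<lambda>_. [:c:]"], rule exI[of _ 0]) (simp add: polyfun.polyfun_const)
next
  case (polyfun_coord i)
  have "polyfun I (\<lambda>w. coeff [:a i, w i:] j)" for j
  proof -
    consider "j = 0" | "j = 1" | k where "j = Suc (Suc k)" by (metis One_nat_def not0_implies_Suc)
    then show ?thesis
      by cases (auto intro: polyfun.polyfun_const polyfun.polyfun_coord polyfun_coord)
  qed
  then show ?case
    by (intro exI[of _ "\<lambda>w. [:a i, w i:]"] exI[of _ 1]) simp
next
  case (polyfun_add f g)
  then obtain P m Q n where
    "\<forall>w t. f (\<lambda>i. a i + t * w i) = poly (P w) t" "\<forall>w. degree (P w) \<le> m"
    "\<forall>j. polyfun I (\<lambda>w. coeff (P w) j)"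
    "\<forall>w t. g (\<lambda>i. a i + t * w i) = poly (Q w) t" "\<forall>w. degree (Q w) \<le> n"
    "\<forall>j. polyfun I (\<lambda>w. coeff (Q w) j)" by metis
  moreover from this have "degree (P w + Q w) \<le> max m n" for w
    by (intro degree_add_le) (auto intro: max.coboundedI1 max.coboundedI2)
  ultimately show ?case
    by (intro exI[of _ "\<lambda>w. P w + Q w"] exI[of _ "max m n"]) (auto intro: polyfun.polyfun_add)
next
  case (polyfun_mult f g)
  then obtain P m Q n where
    "\<forall>w t. f (\<lambda>i. a i + t * w i) = poly (P w) t" "\<forall>w. degree (P w) \<le> m"
    "\<forall>j. polyfun I (\<lambda>w. coeff (P w) j)"
    "\<forall>w t. g (\<lambda>i. a i + t * w i) = poly (Q w) t" "\<forall>w. degree (Q w) \<le> n"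
    "\<forall>j. polyfun I (\<lambda>w. coeff (Q w) j)" by metis
  moreover from this have "degree (P w * Q w) \<le> m + n" for w
    using degree_mult_le[of "P w" "Q w"] by (meson add_mono order_trans)
  ultimately show ?case
    by (intro exI[of _ "\<lambda>w. P w * Q w"] exI[of _ "m + n"])
      (auto simp: coeff_mult intro!: polyfun_sum polyfun.polyfun_mult)
qed

text \<open>The function \<open>F\<close> is the lowest-order nonzero Taylor coefficient of \<open>f\<close> at \<open>a\<close>. A curve
  through \<open>a\<close> whose velocity is not a zero of \<open>F\<close> leaves the zero set of \<open>f\<close>.\<close>

lemma ex_nonvanishing_velocity:
  fixes f :: "('i \<Rightarrow> real) \<Rightarrow> real"
  assumes f: "polyfun I f" and nz: "\<exists>x. f x \<noteq> 0"
  shows "\<exists>F. polyfun I F \<and> (\<exists>z. F z \<noteq> 0) \<and>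
    (\<forall>z w. F z \<noteq> 0 \<longrightarrow> (\<forall>i\<in>I. ((\<lambda>t. w t i) \<longlongrightarrow> z i) (at 0)) \<longrightarrow>
      (\<forall>\<^sub>F t in at 0. f (\<lambda>i. a i + t * w t i) \<noteq> 0))"
proof -
  obtain P n where P: "\<And>w t. f (\<lambda>i. a i + t * w i) = poly (P w) t"
    and deg: "\<And>w. degree (P w) \<le> n" and cf: "\<And>j. polyfun I (\<lambda>w. coeff (P w) j)"
    using polyfun_expand_along_rays[OF f] by metis
  obtain x where x: "f x \<noteq> 0" using nz by blast
  \<comment> \<open>In the direction from \<open>a\<close> to \<open>x\<close> the parameter 1
    reaches \<open>x\<close>, so some coefficient is not identically zero in
    \<open>w\<close>.\<close>
  have "poly (P (\<lambda>i. x i - a i)) 1 \<noteq> 0" using x P[of 1 "\<lambda>i. x i - a i"] by simp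
  then have "\<exists>j w. coeff (P w) j \<noteq> 0" by (metis leading_coeff_0_iff poly_0)
  then obtain k where k: "\<exists>w. coeff (P w) k \<noteq> 0" and least: "\<And>j w. j < k \<Longrightarrow> coeff (P w) j = 0"
    using exists_least_iff[of "\<lambda>j. \<exists>w. coeff (P w) j \<noteq> 0"] by blast
  have kn: "k \<le> n" using k deg by (metis coeff_eq_0 le_trans not_le)
  \<comment> \<open>The coefficients below \<open>k\<close> vanish for every direction, so the
    factorization remains valid when the direction moves with \<open>t\<close>.\<close>
  have exp: "poly (P w) t = t ^ k * (\<Sum>j=k..n. coeff (P w) j * t ^ (j - k))" for w t
  proof -
    have "poly (P w) t = (\<Sum>j\<le>n. coeff (P w) j * t ^ j)"
      unfolding poly_altdef using deg
      by (intro sum.mono_neutral_left) (auto simp: coeff_eq_0)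
    also have "\<dots> = (\<Sum>j=k..n. coeff (P w) j * t ^ j)"
      using least by (intro sum.mono_neutral_right) (auto simp: not_le)
    also have "\<dots> = (\<Sum>j=k..n. t ^ k * (coeff (P w) j * t ^ (j - k)))"
      by (intro sum.cong) (auto simp: power_add[symmetric])
    finally show ?thesis by (simp add: sum_distrib_left)
  qed
  show ?thesis
  proof (intro exI[of _ "\<lambda>w. coeff (P w) k"] conjI allI impI)
    fix z :: "'i \<Rightarrow> real" and w :: "real \<Rightarrow> 'i \<Rightarrow> real"
    assume z: "coeff (P z) k \<noteq> 0" and w: "\<forall>i\<in>I. ((\<lambda>t. w t i) \<longlongrightarrow> z i) (at 0)"
    have "((\<lambda>t. \<Sum>j=k..n. coeff (P (w t)) j * t ^ (j - k)) \<longlongrightarrow>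
        (\<Sum>j=k..n. coeff (P z) j * 0 ^ (j - k))) (at (0::real))"
      by (intro tendsto_intros polyfun_tendsto[OF cf]) (use w in auto)
    \<comment> \<open>Only \<open>j = k\<close> survives, because \<open>0 ^ 0 = 1\<close>.\<close>
    also have "(\<Sum>j=k..n. coeff (P z) j * 0 ^ (j - k)) = (\<Sum>j\<in>{k}. coeff (P z) j * 0 ^ (j - k))"
      using kn by (intro sum.mono_neutral_right) auto
    finally have "((\<lambda>t. \<Sum>j=k..n. coeff (P (w t)) j * t ^ (j - k)) \<longlongrightarrow> coeff (P z) k) (at 0)"
      by simp
    from tendsto_imp_eventually_ne[OF this z]
    have "\<forall>\<^sub>F t in at 0. (\<Sum>j=k..n. coeff (P (w t)) j * t ^ (j - k)) \<noteq> 0" .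
    moreover have "\<forall>\<^sub>F t in at (0::real). t \<noteq> 0" by (rule eventually_neq_at_within)
    ultimately show "\<forall>\<^sub>F t in at 0. f (\<lambda>i. a i + t * w t i) \<noteq> 0"
      by eventually_elim (simp add: P exp)
  qed (use k cf in auto)
qed

section \<open>Generic points\<close>

text \<open>With the other variables fixed, the sum is a polynomial in the variable \<open>i\<close>
  that vanishes everywhere. Each of its coefficients is therefore zero, and these are polynomials in
  one variable fewer.\<close>

lemma coeffs_zero_if_vanishing:
  fixes c :: "('i \<Rightarrow> nat) \<Rightarrow> real"
  assumes "finite I" "finite M" "\<And>m i. m \<in> M \<Longrightarrow> i \<notin> I \<Longrightarrow> m i = 0"
    and "\<And>x. (\<Sum>m\<in>M. c m * (\<Prod>i\<in>I. x i ^ m i)) = 0"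
    and "m \<in> M"
  shows "c m = 0"
  using assms
proof (induction I arbitrary: M c m rule: finite_induct)
  case empty
  have "m' = m" if "m' \<in> M" for m'
    using empty.prems(2)[OF that] empty.prems(2)[OF empty.prems(4)] by (simp add: fun_eq_iff)
  then have "M = {m}" using empty.prems(4) by blast
  then show ?case using empty.prems(3) by simp
next
  case (insert i I)
  define k where "k = m i"
  define M' where "M' = {m \<in> M. m i = k}"
  \<comment> \<open>Exponent vectors for \<open>I\<close> must vanish at \<open>i\<close>, so the
    exponent \<open>k\<close> is erased from the vector and put back inside the coefficient
    function. All vectors in \<open>M'\<close> have exponent \<open>k\<close> at \<open>i\<close>,
    so erasing it identifies no two of them.\<close>
  have inj: "inj_on (\<lambda>m. m(i := 0)) M'"
    unfolding inj_on_def M'_def by (metis (mono_tags, lifting) fun_upd_triv fun_upd_upd mem_Collect_eq)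
  have "c ((m(i := 0))(i := k)) = 0"
  proof (rule insert.IH[where M = "(\<lambda>m. m(i := 0)) ` M'" and c = "\<lambda>m. c (m(i := k))"])
    show "finite ((\<lambda>m. m(i := 0)) ` M')" using insert.prems(1) by (simp add: M'_def)
    show "m' j = 0" if "m' \<in> (\<lambda>m. m(i := 0)) ` M'" "j \<notin> I" for m' j
      using that insert.prems(2) by (auto simp: M'_def)
    show "m(i := 0) \<in> (\<lambda>m. m(i := 0)) ` M'"
      using insert.prems(4) by (auto simp: M'_def k_def)
    fix x :: "'i \<Rightarrow> real"
    define P where "P = (\<Sum>m\<in>M. monom (c m * (\<Prod>j\<in>I. x j ^ m j)) (m i))"
    have "poly P s = 0" for s
    proof -
      have "poly P s = (\<Sum>m\<in>M. c m * (\<Prod>j\<in>insert i I. (x(i := s)) j ^ m j))"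
        unfolding P_def poly_sum
      proof (rule sum.cong[OF refl])
        fix m
        have "(\<Prod>j\<in>I. (x(i := s)) j ^ m j) = (\<Prod>j\<in>I. x j ^ m j)"
          using insert.hyps by (intro prod.cong) auto
        then show "poly (monom (c m * (\<Prod>j\<in>I. x j ^ m j)) (m i)) s =
            c m * (\<Prod>j\<in>insert i I. (x(i := s)) j ^ m j)"
          using insert.hyps by (simp add: poly_monom)
      qed
      then show ?thesis using insert.prems(3) by simp
    qed
    then have "P = 0" using poly_all_0_iff_0 by blast
    then have "0 = coeff P k" by simp
    also have "\<dots> = (\<Sum>m\<in>M. if m i = k then c m * (\<Prod>j\<in>I. x j ^ m j) else 0)"
      by (simp add: P_def coeff_sum)
    also have "\<dots> = (\<Sum>m\<in>M'. c m * (\<Prod>j\<in>I. x j ^ m j))"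
      using insert.prems(1) by (simp add: M'_def sum.inter_filter)
    also have "\<dots> = (\<Sum>m\<in>M'. c ((m(i := 0))(i := k)) * (\<Prod>j\<in>I. x j ^ (m(i := 0)) j))"
    proof (rule sum.cong[OF refl])
      fix m assume "m \<in> M'"
      then have "(m(i := 0))(i := k) = m" by (auto simp: M'_def)
      moreover have "(\<Prod>j\<in>I. x j ^ (m(i := 0)) j) = (\<Prod>j\<in>I. x j ^ m j)"
        using insert.hyps by (intro prod.cong) auto
      ultimately show "c m * (\<Prod>j\<in>I. x j ^ m j) =
          c ((m(i := 0))(i := k)) * (\<Prod>j\<in>I. x j ^ (m(i := 0)) j)" by simp
    qed
    also have "\<dots> = (\<Sum>m\<in>(\<lambda>m. m(i := 0)) ` M'. c (m(i := k)) * (\<Prod>j\<in>I. x j ^ m j))"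
      by (simp add: sum.reindex[OF inj])
    finally show "(\<Sum>m\<in>(\<lambda>m. m(i := 0)) ` M'. c (m(i := k)) * (\<Prod>j\<in>I. x j ^ m j)) = 0" by simp
  qed
  then show ?case by (simp add: k_def)
qed

text \<open>Genericity becomes avoidance of the zero sets of these countably many functions. Here
  nonzero refers to the coefficients; that the function is then nonzero somewhere is a separate
  fact. In contrast, \<open>polyfun\<close> allows real coefficients, so that variables can be
  frozen at real values.\<close>

definition rat_polyfuns :: "'i set \<Rightarrow> (('i \<Rightarrow> real) \<Rightarrow> real) set" where
  "rat_polyfuns I = {\<lambda>x. \<Sum>m\<in>M. of_rat (c m) * (\<Prod>i\<in>I. x i ^ m i) | M c.
     finite M \<and> (\<forall>m\<in>M. \<forall>i. i \<notin> I \<longrightarrow> m i = 0) \<and> (\<exists>m\<in>M. c m \<noteq> 0)}"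

lemma alg_indep_iff_rat_polyfuns:
  fixes x :: "'i \<Rightarrow> real"
  shows "alg_indep I x \<longleftrightarrow> (\<forall>f\<in>rat_polyfuns I. f x \<noteq> 0)"
proof
  assume indep: "alg_indep I x"
  show "\<forall>f\<in>rat_polyfuns I. f x \<noteq> 0"
  proof
    fix f assume "f \<in> rat_polyfuns I"
    then obtain M c where "f = (\<lambda>x. \<Sum>m\<in>M. of_rat (c m) * (\<Prod>i\<in>I. x i ^ m i))"
      and "finite M" "\<forall>m\<in>M. \<forall>i. i \<notin> I \<longrightarrow> m i = 0" "\<exists>m\<in>M. c m \<noteq> 0"
      unfolding rat_polyfuns_def mem_Collect_eq by (elim exE conjE)
    then show "f x \<noteq> 0" using indep unfolding alg_indep_def by auto
  qed
next
  assume *: "\<forall>f\<in>rat_polyfuns I. f x \<noteq> 0"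
  show "alg_indep I x" unfolding alg_indep_def
  proof (intro allI impI, rule ccontr)
    fix M :: "('i \<Rightarrow> nat) set" and c
    assume M: "finite M \<and> (\<forall>m\<in>M. \<forall>i. i \<notin> I \<longrightarrow> m i = 0) \<and>
      (\<Sum>m\<in>M. real_of_rat (c m) * (\<Prod>i\<in>I. x i ^ m i)) = 0" and "\<not> (\<forall>m\<in>M. c m = 0)"
    then have "(\<lambda>x. \<Sum>m\<in>M. of_rat (c m) * (\<Prod>i\<in>I. x i ^ m i)) \<in> rat_polyfuns I"
      unfolding rat_polyfuns_def mem_Collect_eq by (intro exI[of _ M] exI[of _ c]) simp
    with * have "(\<Sum>m\<in>M. real_of_rat (c m) * (\<Prod>i\<in>I. x i ^ m i)) \<noteq> 0" by (rule bspec)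
    with M show False by simp
  qed
qed

lemma polyfun_rat_polyfuns: "f \<in> rat_polyfuns I \<Longrightarrow> polyfun I f"
  unfolding rat_polyfuns_def
  by (auto intro!: polyfun_sum polyfun_mult polyfun_const polyfun_prod polyfun_power polyfun_coord)

lemma rat_polyfuns_nonzero:
  assumes "finite I" "f \<in> rat_polyfuns I"
  shows "\<exists>x. f x \<noteq> 0"
proof (rule ccontr)
  assume z: "\<nexists>x. f x \<noteq> 0"
  obtain M c m where f: "f = (\<lambda>x. \<Sum>m\<in>M. of_rat (c m) * (\<Prod>i\<in>I. x i ^ m i))"
    and M: "finite M" "\<forall>m\<in>M. \<forall>i. i \<notin> I \<longrightarrow> m i = 0" "m \<in> M" "c m \<noteq> 0"
    using assms(2) unfolding rat_polyfuns_def by auto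
  have "real_of_rat (c m) = 0"
    by (rule coeffs_zero_if_vanishing[OF assms(1) M(1) _ _ M(3)])
      (use M(2) z f in \<open>auto simp: fun_eq_iff\<close>)
  then show False using M(4) by simp
qed

lemma countable_rat_polyfuns:
  fixes I :: "'i set"
  assumes "finite I"
  shows "countable (rat_polyfuns I)"
proof -
  define X where "X = {m :: 'i \<Rightarrow> nat. \<forall>i. i \<notin> I \<longrightarrow> m i = 0}"
  define ev where "ev = (\<lambda>(M, c) (x :: 'i \<Rightarrow> real). \<Sum>m\<in>M. of_rat (c m) * (\<Prod>i\<in>I. x i ^ m i))"
  have "X \<subseteq> (\<lambda>g i. if i \<in> I then g i else 0) ` (PiE I (\<lambda>_. UNIV))"
  proof
    fix m assume "m \<in> X"
    then have "m = (\<lambda>i. if i \<in> I then restrict m I i else 0)"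
      by (simp add: X_def fun_eq_iff)
    then show "m \<in> (\<lambda>g i. if i \<in> I then g i else 0) ` (PiE I (\<lambda>_. UNIV))"
      by (rule image_eqI[where x = "restrict m I"]) simp
  qed
  then have "countable X"
    by (rule countable_subset) (intro countable_image countable_PiE assms countableI_type)
  then have "countable (Sigma {M. M \<subseteq> X \<and> finite M} (\<lambda>M. PiE M (\<lambda>_. UNIV :: rat set)))"
    using countable_Collect_finite_subset[of X]
    by (intro countable_SIGMA countable_PiE countableI_type) (auto simp: conj_commute)
  moreover have "rat_polyfuns I \<subseteq>
      ev ` Sigma {M. M \<subseteq> X \<and> finite M} (\<lambda>M. PiE M (\<lambda>_. UNIV :: rat set))"
  proof
    fix f assume "f \<in> rat_polyfuns I"
    then obtain M c where f: "f = (\<lambda>x. \<Sum>m\<in>M. of_rat (c m) * (\<Prod>i\<in>I. x i ^ m i))"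
      and M: "finite M" "\<forall>m\<in>M. \<forall>i. i \<notin> I \<longrightarrow> m i = 0"
      unfolding rat_polyfuns_def by auto
    \<comment> \<open>Unrestricted functions \<open>c\<close> would form an uncountable set;
      restricted to the finite set \<open>M\<close> they are countably many.\<close>
    have "f = ev (M, restrict c M)" unfolding f ev_def by (auto simp: fun_eq_iff intro: sum.cong)
    moreover have "(M, restrict c M) \<in> Sigma {M. M \<subseteq> X \<and> finite M} (\<lambda>M. PiE M (\<lambda>_. UNIV))"
      using M by (auto simp: X_def)
    ultimately show "f \<in> ev ` Sigma {M. M \<subseteq> X \<and> finite M} (\<lambda>M. PiE M (\<lambda>_. UNIV))" by blast
  qed
  ultimately show ?thesis by (meson countable_image countable_subset)
qed

text \<open>Lets frameworks constructed over the reals enter the complex definition of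
  reconstructibility.\<close>

lemma alg_indep_of_real:
  assumes "alg_indep I (x :: 'i \<Rightarrow> real)"
  shows "alg_indep I (\<lambda>i. complex_of_real (x i))"
  unfolding alg_indep_def
proof (intro allI impI)
  fix M :: "('i \<Rightarrow> nat) set" and c :: "('i \<Rightarrow> nat) \<Rightarrow> rat"
  assume *: "finite M \<and> (\<forall>m\<in>M. \<forall>i. i \<notin> I \<longrightarrow> m i = 0) \<and>
    (\<Sum>m\<in>M. of_rat (c m) * (\<Prod>i\<in>I. complex_of_real (x i) ^ m i)) = 0"
  have of_rat: "of_rat r = complex_of_real (of_rat r)" for r
    by (cases r) (simp add: of_rat_rat)
  have "complex_of_real (\<Sum>m\<in>M. of_rat (c m) * (\<Prod>i\<in>I. x i ^ m i)) = 0"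
    using * by (simp add: of_rat)
  then have "(\<Sum>m\<in>M. of_rat (c m) * (\<Prod>i\<in>I. x i ^ m i)) = 0" by (simp only: of_real_eq_0_iff)
  with * assms show "\<forall>m\<in>M. c m = 0" unfolding alg_indep_def by blast
qed

section \<open>Linear independence and circuits\<close>

text \<open>The coefficients are indexed by \<open>e\<close> and not by the rows as vectors, so two
  distinct edges with equal rows are dependent, as in \<open>rows_indep\<close>.\<close>

definition lin_indep :: "'k set \<Rightarrow> ('e \<Rightarrow> 'k \<Rightarrow> real) \<Rightarrow> 'e set \<Rightarrow> bool" where
  "lin_indep K r S \<longleftrightarrow>
     (\<forall>c. (\<forall>k\<in>K. (\<Sum>e\<in>S. c e * r e k) = 0) \<longrightarrow> (\<forall>e\<in>S. c e = 0))"

definition lin_circuit :: "'k set \<Rightarrow> ('e \<Rightarrow> 'k \<Rightarrow> real) \<Rightarrow> 'e set \<Rightarrow> bool" where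
  "lin_circuit K r C \<longleftrightarrow> \<not> lin_indep K r C \<and> (\<forall>D. D \<subset> C \<longrightarrow> lin_indep K r D)"

lemma lin_indepD:
  "lin_indep K r S \<Longrightarrow> (\<And>k. k \<in> K \<Longrightarrow> (\<Sum>e\<in>S. c e * r e k) = 0) \<Longrightarrow> e \<in> S \<Longrightarrow> c e = 0"
  unfolding lin_indep_def by blast

lemma lin_indepI:
  "(\<And>c e. (\<And>k. k \<in> K \<Longrightarrow> (\<Sum>e\<in>S. c e * r e k) = 0) \<Longrightarrow> e \<in> S \<Longrightarrow> c e = 0) \<Longrightarrow> lin_indep K r S"
  unfolding lin_indep_def by blast

lemma lin_indep_cong:
  assumes "\<And>e k. e \<in> S \<Longrightarrow> k \<in> K \<Longrightarrow> r e k = r' e k"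
  shows "lin_indep K r S \<longleftrightarrow> lin_indep K r' S"
proof -
  have "(\<Sum>e\<in>S. c e * r e k) = (\<Sum>e\<in>S. c e * r' e k)" if "k \<in> K" for c k
    using assms that by (intro sum.cong) auto
  then show ?thesis unfolding lin_indep_def by simp
qed

lemma lin_indep_subset:
  assumes "lin_indep K r S" "T \<subseteq> S" "finite S"
  shows "lin_indep K r T"
proof (rule lin_indepI)
  fix c e assume c: "\<And>k. k \<in> K \<Longrightarrow> (\<Sum>e\<in>T. c e * r e k) = 0" and e: "e \<in> T"
  have "(\<Sum>e\<in>S. (if e \<in> T then c e else 0) * r e k) = (\<Sum>e\<in>T. c e * r e k)" for k
    using assms by (intro sum.mono_neutral_cong_right) auto
  then have "(if e \<in> T then c e else 0) = 0"
    using lin_indepD[OF assms(1), of "\<lambda>e. if e \<in> T then c e else 0" e] c e assms(2) by auto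
  then show "c e = 0" using e by simp
qed

text \<open>Fraction-free Gaussian elimination: a pivot entry that is nonzero at \<open>x\<^sub>0\<close> clears its
  column from the other rows, and \<open>D\<close> is the product of the pivots.\<close>

lemma polyfun_right_inverse:
  fixes r :: "'e \<Rightarrow> 'k \<Rightarrow> ('j \<Rightarrow> real) \<Rightarrow> real"
  assumes "finite S" "finite K"
    and "\<And>e k. e \<in> S \<Longrightarrow> k \<in> K \<Longrightarrow> polyfun J (r e k)"
    and "lin_indep K (\<lambda>e k. r e k x\<^sub>0) S"
  shows "\<exists>D. polyfun J D \<and> D x\<^sub>0 \<noteq> 0 \<and>
    (\<forall>b. (\<forall>e\<in>S. polyfun J (b e)) \<longrightarrow>
      (\<exists>u. (\<forall>k\<in>K. polyfun J (u k)) \<and>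
        (\<forall>x. \<forall>e\<in>S. (\<Sum>k\<in>K. r e k x * u k x) = D x * b e x)))"
  using assms(1,3,4)
proof (induction S arbitrary: r rule: finite_induct)
  case empty
  show ?case
    by (rule exI[of _ "\<lambda>_. 1"]) (auto intro!: polyfun_const exI[of _ "\<lambda>_ _. 0"])
next
  case (insert i S)
  have "\<exists>c\<in>K. r i c x\<^sub>0 \<noteq> 0"
  proof (rule ccontr)
    assume *: "\<not> (\<exists>c\<in>K. r i c x\<^sub>0 \<noteq> 0)"
    have "(if i = i then 1 else 0 :: real) = 0"
      by (rule lin_indepD[OF insert.prems(2), of "\<lambda>e. if e = i then 1 else 0"])
        (use * insert.hyps in \<open>auto simp: if_distrib[where f = "\<lambda>x. x * _"] cong: if_cong\<close>)
    then show False by simp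
  qed
  then obtain c where c: "c \<in> K" "r i c x\<^sub>0 \<noteq> 0" by blast
  define r' where "r' e k x = r i c x * r e k x - r e c x * r i k x" for e k x
  have "\<exists>D. polyfun J D \<and> D x\<^sub>0 \<noteq> 0 \<and>
    (\<forall>b. (\<forall>e\<in>S. polyfun J (b e)) \<longrightarrow>
      (\<exists>u. (\<forall>k\<in>K. polyfun J (u k)) \<and>
        (\<forall>x. \<forall>e\<in>S. (\<Sum>k\<in>K. r' e k x * u k x) = D x * b e x)))"
  proof (rule insert.IH)
    show "polyfun J (r' e k)" if "e \<in> S" "k \<in> K" for e k
      unfolding r'_def using that c insert.prems(1) by (intro polyfun_diff polyfun_mult) auto
    show "lin_indep K (\<lambda>e k. r' e k x\<^sub>0) S"
    proof (rule lin_indepI)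
      fix a e assume a: "\<And>k. k \<in> K \<Longrightarrow> (\<Sum>e\<in>S. a e * r' e k x\<^sub>0) = 0" and e: "e \<in> S"
      \<comment> \<open>Undoing the elimination: row \<open>i\<close> absorbs the multiples of the
        pivot row that were subtracted from the others.\<close>
      define a' where
        "a' e = (if e = i then - (\<Sum>e\<in>S. a e * r e c x\<^sub>0) else a e * r i c x\<^sub>0)" for e
      have "a' e = 0"
      proof (rule lin_indepD[OF insert.prems(2)])
        fix k assume k: "k \<in> K"
        have "(\<Sum>e\<in>S. a' e * r e k x\<^sub>0) = (\<Sum>e\<in>S. a e * r i c x\<^sub>0 * r e k x\<^sub>0)"
          using insert.hyps by (intro sum.cong) (auto simp: a'_def)
        then have "(\<Sum>e\<in>insert i S. a' e * r e k x\<^sub>0) =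
            (\<Sum>e\<in>S. a e * r i c x\<^sub>0 * r e k x\<^sub>0) - (\<Sum>e\<in>S. a e * r e c x\<^sub>0) * r i k x\<^sub>0"
          using insert.hyps by (simp add: a'_def)
        also have "\<dots> = (\<Sum>e\<in>S. a e * r' e k x\<^sub>0)"
          by (simp add: r'_def sum_distrib_left sum_subtractf algebra_simps)
        finally show "(\<Sum>e\<in>insert i S. a' e * r e k x\<^sub>0) = 0" using a[OF k] by simp
      qed (use e in simp)
      then show "a e = 0" using e insert.hyps c by (auto simp: a'_def split: if_splits)
    qed
  qed
  then obtain D' where D': "polyfun J D'" "D' x\<^sub>0 \<noteq> 0"
    and sol: "\<And>b. (\<forall>e\<in>S. polyfun J (b e)) \<Longrightarrow>
      (\<exists>u. (\<forall>k\<in>K. polyfun J (u k)) \<and>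
        (\<forall>x. \<forall>e\<in>S. (\<Sum>k\<in>K. r' e k x * u k x) = D' x * b e x))"
    by blast
  have pic: "polyfun J (r i c)" using insert.prems(1) c by simp
  show ?case
  proof (intro exI[of _ "\<lambda>x. r i c x * D' x"] conjI allI impI)
    show "polyfun J (\<lambda>x. r i c x * D' x)" by (intro polyfun_mult pic D')
    show "r i c x\<^sub>0 * D' x\<^sub>0 \<noteq> 0" using c D' by simp
    fix b assume b: "\<forall>e\<in>insert i S. polyfun J (b e)"
    define b' where "b' e x = r i c x * b e x - r e c x * b i x" for e x
    have "\<forall>e\<in>S. polyfun J (b' e)"
      unfolding b'_def using b insert.prems(1) c
      by (intro ballI polyfun_diff polyfun_mult) auto
    then obtain u' where u': "\<And>k. k \<in> K \<Longrightarrow> polyfun J (u' k)"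
      and eq: "\<And>x e. e \<in> S \<Longrightarrow> (\<Sum>k\<in>K. r' e k x * u' k x) = D' x * b' e x"
      using sol by blast
    \<comment> \<open>Column \<open>c\<close> of \<open>r'\<close> is zero, so the entry at
      \<open>c\<close> is free to be set to what row \<open>i\<close> forces. The other entries are
      scaled by the pivot instead of dividing this one by it.\<close>
    define u where "u k = (if k = c then (\<lambda>x. D' x * b i x - (\<Sum>k\<in>K-{c}. r i k x * u' k x))
      else (\<lambda>x. r i c x * u' k x))" for k
    have split: "(\<Sum>k\<in>K. f k) = f c + (\<Sum>k\<in>K-{c}. f k)" for f :: "'k \<Rightarrow> real"
      using sum.remove[OF assms(2) c(1)] .
    have sum_u: "(\<Sum>k\<in>K. r e k x * u k x) =
        r e c x * (D' x * b i x - (\<Sum>k\<in>K-{c}. r i k x * u' k x)) +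
        (\<Sum>k\<in>K-{c}. r e k x * (r i c x * u' k x))" for e x
    proof -
      have "(\<Sum>k\<in>K-{c}. r e k x * u k x) = (\<Sum>k\<in>K-{c}. r e k x * (r i c x * u' k x))"
        by (intro sum.cong) (auto simp: u_def)
      then show ?thesis by (simp add: split) (simp add: u_def)
    qed
    show "\<exists>u. (\<forall>k\<in>K. polyfun J (u k)) \<and>
        (\<forall>x. \<forall>e\<in>insert i S. (\<Sum>k\<in>K. r e k x * u k x) = r i c x * D' x * b e x)"
    proof (intro exI[of _ u] conjI ballI allI)
      fix k assume "k \<in> K"
      then show "polyfun J (u k)"
        unfolding u_def using b insert.prems(1) c u' D'
        by (auto intro!: polyfun_diff polyfun_mult polyfun_sum)
    next
      fix x e assume e: "e \<in> insert i S"
      show "(\<Sum>k\<in>K. r e k x * u k x) = r i c x * D' x * b e x"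
      proof (cases "e = i")
        case True
        have "(\<Sum>k\<in>K-{c}. r i k x * (r i c x * u' k x)) = r i c x * (\<Sum>k\<in>K-{c}. r i k x * u' k x)"
          by (simp add: sum_distrib_left mult_ac)
        then show ?thesis unfolding True sum_u by (simp add: algebra_simps)
      next
        case False
        then have eS: "e \<in> S" using e by simp
        have "D' x * b' e x = (\<Sum>k\<in>K-{c}. r' e k x * u' k x)"
          using eq[OF eS, of x] by (simp add: split r'_def)
        also have "\<dots> = (\<Sum>k\<in>K-{c}. r e k x * (r i c x * u' k x)) -
            r e c x * (\<Sum>k\<in>K-{c}. r i k x * u' k x)"
          by (simp add: r'_def sum_distrib_left sum_subtractf algebra_simps)
        finally show ?thesis unfolding sum_u b'_def by (simp add: algebra_simps)
      qed
    qed
  qed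
qed

text \<open>Pairing a dependency with the solution for the indicator of \<open>e\<close> isolates
  \<open>c e * D x\<close>. Hence \<open>D\<close> certifies independence at every point where it is
  nonzero, not only at the point it was built from.\<close>

lemma polyfun_right_inverse_imp_lin_indep:
  assumes fin: "finite S"
    and sol: "\<forall>b. (\<forall>e\<in>S. polyfun J (b e)) \<longrightarrow>
      (\<exists>u. (\<forall>k\<in>K. polyfun J (u k)) \<and>
        (\<forall>x. \<forall>e\<in>S. (\<Sum>k\<in>K. r e k x * u k x) = D x * b e x))"
    and D: "D x \<noteq> 0"
  shows "lin_indep K (\<lambda>e k. r e k x) S"
proof (rule lin_indepI)
  fix c e assume c: "\<And>k. k \<in> K \<Longrightarrow> (\<Sum>e\<in>S. c e * r e k x) = 0" and e: "e \<in> S"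
  have "\<exists>u. (\<forall>k\<in>K. polyfun J (u k)) \<and>
        (\<forall>x. \<forall>g\<in>S. (\<Sum>k\<in>K. r g k x * u k x) = D x * (if g = e then 1 else 0))"
    by (rule sol[rule_format]) (rule polyfun_const)
  then obtain u where u: "\<And>g. g \<in> S \<Longrightarrow> (\<Sum>k\<in>K. r g k x * u k x) = D x * (if g = e then 1 else 0)"
    by blast
  have "0 = (\<Sum>k\<in>K. (\<Sum>g\<in>S. c g * r g k x) * u k x)" using c by simp
  also have "\<dots> = (\<Sum>g\<in>S. c g * (\<Sum>k\<in>K. r g k x * u k x))"
    by (simp add: sum_distrib_left sum_distrib_right mult_ac) (rule sum.swap)
  also have "\<dots> = (\<Sum>g\<in>S. if g = e then c e * D x else 0)"
    by (intro sum.cong) (auto simp: u)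
  also have "\<dots> = c e * D x" using fin e by simp
  finally show "c e = 0" using D by simp
qed

section \<open>Circuits of a linear matroid and its separations\<close>

lemma circuit_in_support:
  assumes "finite E" "\<And>k. k \<in> K \<Longrightarrow> (\<Sum>e\<in>E. c e * r e k) = 0" "e \<in> E" "c e \<noteq> 0"
  shows "\<exists>C. lin_circuit K r C \<and> e \<in> C \<and> C \<subseteq> {g \<in> E. c g \<noteq> 0}"
  using assms(2,4)
proof (induction "card {g \<in> E. c g \<noteq> 0}" arbitrary: c rule: less_induct)
  case less
  let ?T = "{g \<in> E. c g \<noteq> 0}"
  have T: "finite ?T" "e \<in> ?T" using assms less.prems by auto
  have "(\<Sum>e\<in>?T. c e * r e k) = (\<Sum>e\<in>E. c e * r e k)" for k
    using assms(1) by (intro sum.mono_neutral_left) auto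
  then have dep: "\<not> lin_indep K r ?T"
    using less.prems lin_indepD[of K r ?T c e] T by auto
  show ?case
  proof (cases "\<forall>D. D \<subset> ?T \<longrightarrow> lin_indep K r D")
    case True
    then show ?thesis using dep T unfolding lin_circuit_def by blast
  next
    case False
    then obtain D where D: "D \<subset> ?T" "\<not> lin_indep K r D" by blast
    then obtain u g where u: "\<And>k. k \<in> K \<Longrightarrow> (\<Sum>e\<in>D. u e * r e k) = 0" "g \<in> D" "u g \<noteq> 0"
      unfolding lin_indep_def by blast
    \<comment> \<open>A dependency on a proper part of the support either involves \<open>e\<close>,
      or can be subtracted to cancel \<open>g\<close> without changing the value at
      \<open>e\<close>. Either way the support shrinks and still contains \<open>e\<close>.\<close>
    define u' where "u' e = (if e \<in> D then u e else 0)" for e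
    have u'_sum: "(\<Sum>e\<in>E. u' e * r e k) = 0" if "k \<in> K" for k
    proof -
      have "(\<Sum>e\<in>E. u' e * r e k) = (\<Sum>e\<in>D. u e * r e k)"
        unfolding u'_def using D assms(1) by (intro sum.mono_neutral_cong_right) auto
      then show ?thesis using u that by simp
    qed
    show ?thesis
    proof (cases "u' e = 0")
      case False
      have sub: "{g \<in> E. u' g \<noteq> 0} \<subset> ?T" using D unfolding u'_def by auto
      have "\<exists>C. lin_circuit K r C \<and> e \<in> C \<and> C \<subseteq> {g \<in> E. u' g \<noteq> 0}"
        by (rule less.hyps[OF psubset_card_mono[OF T(1) sub] u'_sum False])
      then show ?thesis using sub by blast
    next
      case True
      define c' where "c' e = c e - c g / u g * u' e" for e
      have "{g \<in> E. c' g \<noteq> 0} \<subseteq> ?T - {g}" using D u unfolding c'_def u'_def by auto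
      then have sub: "{g \<in> E. c' g \<noteq> 0} \<subset> ?T" using u D by blast
      have "(\<Sum>e\<in>E. c' e * r e k) = 0" if "k \<in> K" for k
      proof -
        have "(\<Sum>e\<in>E. c' e * r e k) = (\<Sum>e\<in>E. c e * r e k) - c g / u g * (\<Sum>e\<in>E. u' e * r e k)"
          unfolding c'_def by (simp add: algebra_simps sum_subtractf sum_distrib_left)
        then show ?thesis using less.prems(1) u'_sum that by simp
      qed
      moreover have "c' e \<noteq> 0" using True less.prems(2) by (simp add: c'_def)
      ultimately have "\<exists>C. lin_circuit K r C \<and> e \<in> C \<and> C \<subseteq> {g \<in> E. c' g \<noteq> 0}"
        by (intro less.hyps[OF psubset_card_mono[OF T(1) sub]])
      then show ?thesis using sub by blast
    qed
  qed
qed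

text \<open>A dependency supported on a proper subset of \<open>C\<close> would yield a smaller
  circuit, so any nontrivial dependency on \<open>C\<close> has full support.\<close>

lemma circuit_dependency:
  assumes "finite E" "lin_circuit K r C" "C \<subseteq> E"
  shows "\<exists>c. (\<forall>k\<in>K. (\<Sum>e\<in>E. c e * r e k) = 0) \<and> {e \<in> E. c e \<noteq> 0} = C"
proof -
  obtain u g where u: "\<And>k. k \<in> K \<Longrightarrow> (\<Sum>e\<in>C. u e * r e k) = 0" "g \<in> C" "u g \<noteq> 0"
    using assms(2) unfolding lin_circuit_def lin_indep_def by blast
  define c where "c e = (if e \<in> C then u e else 0)" for e
  have c: "(\<Sum>e\<in>E. c e * r e k) = 0" if "k \<in> K" for k
  proof -
    have "(\<Sum>e\<in>E. c e * r e k) = (\<Sum>e\<in>C. u e * r e k)"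
      unfolding c_def using assms by (intro sum.mono_neutral_cong_right) auto
    then show ?thesis using u that by simp
  qed
  have "{e \<in> E. c e \<noteq> 0} = C"
  proof (rule ccontr)
    assume ne: "{e \<in> E. c e \<noteq> 0} \<noteq> C"
    obtain C' where C': "lin_circuit K r C'" "C' \<subseteq> {e \<in> E. c e \<noteq> 0}"
      using circuit_in_support[of E K c r g] assms(1,3) c u(2,3) by (auto simp: c_def)
    moreover have "{e \<in> E. c e \<noteq> 0} \<subseteq> C" by (auto simp: c_def)
    ultimately have "C' \<subset> C" using ne by blast
    then show False using C' assms(2) unfolding lin_circuit_def by blast
  qed
  then show ?thesis using c by blast
qed

text \<open>Two dependencies with these circuits as exact supports are combined so that the value at
  \<open>g\<close> cancels; since \<open>e\<close> lies outside the second circuit, its coefficient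
  survives.\<close>

lemma strong_circuit_elimination:
  assumes fin: "finite E" and C: "lin_circuit K r C\<^sub>1" "C\<^sub>1 \<subseteq> E" "lin_circuit K r C\<^sub>2" "C\<^sub>2 \<subseteq> E"
    and g: "g \<in> C\<^sub>1" "g \<in> C\<^sub>2" and e: "e \<in> C\<^sub>1" "e \<notin> C\<^sub>2"
  shows "\<exists>C. lin_circuit K r C \<and> e \<in> C \<and> C \<subseteq> C\<^sub>1 \<union> C\<^sub>2 - {g}"
proof -
  obtain a where a: "\<forall>k\<in>K. (\<Sum>e\<in>E. a e * r e k) = 0" "{e \<in> E. a e \<noteq> 0} = C\<^sub>1"
    using circuit_dependency[OF fin C(1,2)] by blast
  obtain b where b: "\<forall>k\<in>K. (\<Sum>e\<in>E. b e * r e k) = 0" "{e \<in> E. b e \<noteq> 0} = C\<^sub>2"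
    using circuit_dependency[OF fin C(3,4)] by blast
  define c where "c e = a e - a g / b g * b e" for e
  have sum_c: "(\<Sum>e\<in>E. c e * r e k) = 0" if "k \<in> K" for k
  proof -
    have "(\<Sum>e\<in>E. c e * r e k) = (\<Sum>e\<in>E. a e * r e k) - a g / b g * (\<Sum>e\<in>E. b e * r e k)"
      unfolding c_def by (simp add: algebra_simps sum_subtractf sum_distrib_left)
    then show ?thesis using a b that by simp
  qed
  have "e \<in> E" "c e \<noteq> 0" using a b e by (auto simp: c_def)
  from circuit_in_support[of E K c r e, OF fin sum_c this]
  obtain C where "lin_circuit K r C" "e \<in> C" "C \<subseteq> {g \<in> E. c g \<noteq> 0}" by blast
  moreover have "{g \<in> E. c g \<noteq> 0} \<subseteq> C\<^sub>1 \<union> C\<^sub>2 - {g}" using a b g by (auto simp: c_def)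
  ultimately show ?thesis by blast
qed

text \<open>Eliminating a common element \<open>g\<close> in both directions gives circuits
  \<open>C\<^sub>3\<close> through \<open>e\<close> and \<open>C\<^sub>4\<close> through
  \<open>f\<close>. Either \<open>C\<^sub>3\<close> with \<open>C\<^sub>2\<close>, or
  \<open>C\<^sub>3\<close> with \<open>C\<^sub>4\<close>, is an intersecting pair with a smaller
  union.\<close>

lemma circuit_transitive:
  assumes fin: "finite E"
    and "lin_circuit K r C\<^sub>1" "C\<^sub>1 \<subseteq> E" "lin_circuit K r C\<^sub>2" "C\<^sub>2 \<subseteq> E"
    and "e \<in> C\<^sub>1" "f \<in> C\<^sub>2" "C\<^sub>1 \<inter> C\<^sub>2 \<noteq> {}"
  shows "\<exists>C. lin_circuit K r C \<and> C \<subseteq> E \<and> e \<in> C \<and> f \<in> C"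
  using assms(2-)
proof (induction "card (C\<^sub>1 \<union> C\<^sub>2)" arbitrary: C\<^sub>1 C\<^sub>2 rule: less_induct)
  case less
  have finU: "finite (C\<^sub>1 \<union> C\<^sub>2)" using less.prems fin by (meson finite_UnI finite_subset)
  show ?case
  proof (cases "e \<in> C\<^sub>2 \<or> f \<in> C\<^sub>1")
    case True
    then show ?thesis using less.prems by blast
  next
    case False
    obtain g where g: "g \<in> C\<^sub>1" "g \<in> C\<^sub>2" using less.prems by blast
    obtain C\<^sub>3 where C3: "lin_circuit K r C\<^sub>3" "e \<in> C\<^sub>3" "C\<^sub>3 \<subseteq> C\<^sub>1 \<union> C\<^sub>2 - {g}"
      using strong_circuit_elimination[OF fin less.prems(1-4) g] less.prems False by blast
    obtain C\<^sub>4 where C4: "lin_circuit K r C\<^sub>4" "f \<in> C\<^sub>4" "C\<^sub>4 \<subseteq> C\<^sub>2 \<union> C\<^sub>1 - {g}"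
      using strong_circuit_elimination[OF fin less.prems(3,4,1,2) g(2,1)] less.prems False by blast
    have E: "C\<^sub>3 \<subseteq> E" "C\<^sub>4 \<subseteq> E" using C3 C4 less.prems by blast+
    have "\<not> C\<^sub>3 \<subset> C\<^sub>1" "\<not> C\<^sub>4 \<subset> C\<^sub>2" using less.prems C3 C4 unfolding lin_circuit_def by blast+
    \<comment> \<open>Otherwise one of the new circuits, which avoid \<open>g\<close>, would lie
      properly inside an old one.\<close>
    then have m: "C\<^sub>3 \<inter> C\<^sub>2 \<noteq> {}" "C\<^sub>4 \<inter> (C\<^sub>1 - C\<^sub>2) \<noteq> {}" using C3 C4 g by blast+
    show ?thesis
    proof (cases "C\<^sub>3 \<union> C\<^sub>2 = C\<^sub>1 \<union> C\<^sub>2")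
      case False
      then have "C\<^sub>3 \<union> C\<^sub>2 \<subset> C\<^sub>1 \<union> C\<^sub>2" using C3 by blast
      from less.hyps[OF psubset_card_mono[OF finU this] C3(1) E(1) less.prems(3,4) C3(2) less.prems(6) m(1)]
      show ?thesis .
    next
      case True
      \<comment> \<open>\<open>C\<^sub>3\<close> covers \<open>C\<^sub>1 - C\<^sub>2\<close>, where
        \<open>C\<^sub>4\<close> has an element.\<close>
      then have "C\<^sub>3 \<inter> C\<^sub>4 \<noteq> {}" using m by blast
      moreover have "C\<^sub>3 \<union> C\<^sub>4 \<subset> C\<^sub>1 \<union> C\<^sub>2" using C3 C4 g by blast
      ultimately show ?thesis
        using less.hyps[OF psubset_card_mono[OF finU], of C\<^sub>3 C\<^sub>4] C3 C4 E by blast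
    qed
  qed
qed

text \<open>Every circuit lies inside or outside the class of elements joined to \<open>e\<close> by
  a circuit. Every dependency is a combination of dependencies on circuits, so it restricts to this
  class.\<close>

lemma separation_if_no_common_circuit:
  assumes fin: "finite E" and ef: "e \<in> E" "f \<in> E" "e \<noteq> f"
    and none: "\<And>C. lin_circuit K r C \<Longrightarrow> C \<subseteq> E \<Longrightarrow> e \<in> C \<Longrightarrow> f \<notin> C"
  shows "\<exists>E\<^sub>1 \<subseteq> E. e \<in> E\<^sub>1 \<and> f \<notin> E\<^sub>1 \<and>
    (\<forall>c. (\<forall>k\<in>K. (\<Sum>e\<in>E. c e * r e k) = 0) \<longrightarrow> (\<forall>k\<in>K. (\<Sum>e\<in>E\<^sub>1. c e * r e k) = 0))"
proof -
  \<comment> \<open>The clause \<open>g = e\<close> keeps \<open>e\<close> in its class even if no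
    circuit contains it.\<close>
  define E\<^sub>1 where "E\<^sub>1 = {g \<in> E. g = e \<or> (\<exists>C. lin_circuit K r C \<and> C \<subseteq> E \<and> e \<in> C \<and> g \<in> C)}"
  have closed: "C \<subseteq> E\<^sub>1" if C: "lin_circuit K r C" "C \<subseteq> E" "C \<inter> E\<^sub>1 \<noteq> {}" for C
  proof
    fix h assume h: "h \<in> C"
    obtain g where g: "g \<in> C" "g \<in> E\<^sub>1" using C by blast
    show "h \<in> E\<^sub>1"
    proof (cases "g = e")
      case True
      then show ?thesis using C g h unfolding E\<^sub>1_def by blast
    next
      case False
      then obtain C' where C': "lin_circuit K r C'" "C' \<subseteq> E" "e \<in> C'" "g \<in> C'"
        using g unfolding E\<^sub>1_def by blast
      have "\<exists>C. lin_circuit K r C \<and> C \<subseteq> E \<and> e \<in> C \<and> h \<in> C"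
        by (rule circuit_transitive[OF fin C'(1,2) C(1,2) C'(3) h]) (use g C' in blast)
      then show ?thesis using C h unfolding E\<^sub>1_def by blast
    qed
  qed
  have "(\<Sum>e\<in>E\<^sub>1. c e * r e k) = 0" if "\<forall>k\<in>K. (\<Sum>e\<in>E. c e * r e k) = 0" "k \<in> K" for c k
    using that
  proof (induction "card {g \<in> E. c g \<noteq> 0}" arbitrary: c rule: less_induct)
    case less
    let ?T = "{g \<in> E. c g \<noteq> 0}"
    show ?case
    proof (cases "?T = {}")
      case True
      then show ?thesis unfolding E\<^sub>1_def by (intro sum.neutral) auto
    next
      case False
      then obtain g where g: "g \<in> E" "c g \<noteq> 0" by blast
      obtain C where C: "lin_circuit K r C" "g \<in> C" "C \<subseteq> ?T"
        using circuit_in_support[of E K c r g, OF fin _ g] less.prems by blast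
      then have CE: "C \<subseteq> E" by blast
      obtain u where u: "\<forall>k\<in>K. (\<Sum>e\<in>E. u e * r e k) = 0" "{e \<in> E. u e \<noteq> 0} = C"
        using circuit_dependency[OF fin C(1) CE] by blast
      have u1: "(\<Sum>e\<in>E\<^sub>1. u e * r e k) = 0"
      proof (cases "C \<inter> E\<^sub>1 = {}")
        case True
        then show ?thesis using u(2) unfolding E\<^sub>1_def by (intro sum.neutral) auto
      next
        case False
        then have "C \<subseteq> E\<^sub>1" using closed[OF C(1) CE] by blast
        then have "(\<Sum>e\<in>E\<^sub>1. u e * r e k) = (\<Sum>e\<in>E. u e * r e k)"
          using fin u(2) unfolding E\<^sub>1_def by (intro sum.mono_neutral_left) auto
        then show ?thesis using u(1) less.prems by simp
      qed
      define c' where "c' e = c e - c g / u g * u e" for e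
      have lin: "(\<Sum>e\<in>A. c' e * r e k) = (\<Sum>e\<in>A. c e * r e k) - c g / u g * (\<Sum>e\<in>A. u e * r e k)"
        for A k
        unfolding c'_def by (simp add: algebra_simps sum_subtractf sum_distrib_left)
      have "{g \<in> E. c' g \<noteq> 0} \<subseteq> ?T" using C(3) u(2) unfolding c'_def by auto
      moreover have "u g \<noteq> 0" using C(2) u(2) by blast
      then have "c' g = 0" by (simp add: c'_def)
      ultimately have "{g \<in> E. c' g \<noteq> 0} \<subset> ?T" using g by blast
      then have "card {g \<in> E. c' g \<noteq> 0} < card ?T" using fin by (intro psubset_card_mono) auto
      then have "(\<Sum>e\<in>E\<^sub>1. c' e * r e k) = 0"
        by (rule less.hyps) (use less.prems u(1) lin in auto)
      then show ?thesis using lin u1 by simp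
    qed
  qed
  moreover have "E\<^sub>1 \<subseteq> E" "e \<in> E\<^sub>1" "f \<notin> E\<^sub>1" using ef none unfolding E\<^sub>1_def by auto
  ultimately show ?thesis by blast
qed

lemma ex_maximal_lin_indep:
  assumes "finite E"
  shows "\<exists>B\<subseteq>E. lin_indep K r B \<and> (\<forall>e\<in>E-B. \<not> lin_indep K r (insert e B))"
proof -
  let ?\<B> = "{B. B \<subseteq> E \<and> lin_indep K r B}"
  have "finite ?\<B>" using assms by simp
  moreover have "{} \<in> ?\<B>" by (simp add: lin_indep_def)
  ultimately obtain B where B: "B \<in> ?\<B>" "\<And>C. C \<in> ?\<B> \<Longrightarrow> B \<subseteq> C \<Longrightarrow> B = C"
    using finite_has_maximal2[of ?\<B> "{}"] by auto
  have "\<not> lin_indep K r (insert e B)" if "e \<in> E - B" for e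
    using B(1) B(2)[of "insert e B"] that by blast
  then show ?thesis using B by blast
qed

section \<open>Rigidity matrices\<close>

definition rig_row :: "('v \<times> nat \<Rightarrow> real) \<Rightarrow> 'v set \<Rightarrow> 'v \<times> nat \<Rightarrow> real" where
  "rig_row x e i = rig_entry (curry x) e (fst i) (snd i)"

definition real_sqlen :: "nat \<Rightarrow> ('v \<times> nat \<Rightarrow> real) \<Rightarrow> 'v \<Rightarrow> 'v \<Rightarrow> real" where
  "real_sqlen d x u v = (\<Sum>k<d. (x (u, k) - x (v, k))\<^sup>2)"

lemma rows_indep_iff:
  "rows_indep d V p S \<longleftrightarrow> lin_indep (V \<times> {..<d}) (rig_row (\<lambda>(v, k). p v k)) S"
proof -
  have *: "curry (\<lambda>(v, k). p v k) = p" by (simp add: fun_eq_iff)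
  have "(\<forall>i \<in> V \<times> {..<d}. Q i) \<longleftrightarrow> (\<forall>w\<in>V. \<forall>k<d. Q (w, k))" for Q by auto
  then show ?thesis
    unfolding rows_indep_def lin_indep_def rig_row_def * by (simp only: fst_conv snd_conv)
qed

lemma generic_curry: "generic d V (curry x) \<longleftrightarrow> alg_indep (V \<times> {..<d}) x"
proof -
  have "(\<lambda>(v, k). curry x v k) = x" by (simp add: fun_eq_iff)
  then show ?thesis unfolding generic_def by simp
qed

lemma rig_row_linear: "rig_row (\<lambda>i. x i + t * y i) e i = rig_row x e i + t * rig_row y e i"
  by (simp add: rig_row_def rig_entry_def algebra_simps)

lemma rig_row_doubleton:
  assumes "u \<noteq> v"
  shows "rig_row x {u, v} (w, k) =
    (if w = u then x (u, k) - x (v, k) else if w = v then x (v, k) - x (u, k) else 0)"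
proof -
  have "{u, v} - {u} = {v}" "{u, v} - {v} = {u}" using assms by auto
  then show ?thesis by (auto simp: rig_row_def rig_entry_def)
qed

lemma simple_graph_edge:
  assumes "simple_graph V E" "e \<in> E"
  obtains u v where "e = {u, v}" "u \<noteq> v" "u \<in> V" "v \<in> V"
proof -
  have "e \<subseteq> V" "card e = 2" using assms by (auto simp: simple_graph_def)
  then show ?thesis using that by (auto simp: card_2_iff)
qed

lemma simple_graph_finite:
  assumes "simple_graph V E"
  shows "finite V" "finite E"
proof -
  show V: "finite V" using assms by (simp add: simple_graph_def)
  have "E \<subseteq> Pow V" using assms by (auto simp: simple_graph_def)
  then show "finite E" using V finite_subset by auto
qed

lemma polyfun_rig_row:
  assumes "simple_graph V E" "e \<in> E" "i \<in> V \<times> {..<d}"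
  shows "polyfun (V \<times> {..<d}) (\<lambda>x. rig_row x e i)"
proof -
  obtain u v where e: "e = {u, v}" "u \<noteq> v" "u \<in> V" "v \<in> V"
    using simple_graph_edge assms(1,2) by metis
  obtain w k where i: "i = (w, k)" "k < d" using assms(3) by auto
  consider "w = u" | "w = v" "w \<noteq> u" | "w \<noteq> u" "w \<noteq> v" by blast
  then show ?thesis
    unfolding e(1) i(1) rig_row_doubleton[OF e(2)]
    by cases (use e i in \<open>auto intro!: polyfun_diff polyfun_coord polyfun_const\<close>)
qed

text \<open>Only the columns of \<open>u\<close> and \<open>v\<close> contribute. The value is half
  the derivative of the squared length in direction \<open>h\<close>, and it is symmetric in
  \<open>x\<close> and \<open>h\<close>.\<close>

lemma sum_rig_row:
  assumes "finite V" "u \<noteq> v" "u \<in> V" "v \<in> V"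
  shows "(\<Sum>i\<in>V \<times> {..<d}. rig_row x {u, v} i * h i) =
    (\<Sum>k<d. (x (u, k) - x (v, k)) * (h (u, k) - h (v, k)))"
proof -
  have "(\<Sum>w\<in>V. rig_row x {u, v} (w, k) * h (w, k)) =
      (x (u, k) - x (v, k)) * (h (u, k) - h (v, k))" for k
  proof -
    have "(\<Sum>w\<in>V. rig_row x {u, v} (w, k) * h (w, k)) =
        (\<Sum>w\<in>{u, v}. rig_row x {u, v} (w, k) * h (w, k))"
      using assms by (intro sum.mono_neutral_right) (auto simp: rig_row_doubleton)
    then show ?thesis using assms by (simp add: rig_row_doubleton algebra_simps)
  qed
  moreover have "(\<Sum>i\<in>V \<times> {..<d}. rig_row x {u, v} i * h i) =
      (\<Sum>k<d. \<Sum>w\<in>V. rig_row x {u, v} (w, k) * h (w, k))"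
    by (subst sum.swap) (simp add: sum.cartesian_product)
  ultimately show ?thesis by simp
qed

text \<open>Each set that is independent somewhere is independent wherever its certificate
  \<open>D S\<close> is nonzero, and these finitely many conditions are compatible with genericity.
  One \<open>x\<^sub>0\<close> thus replaces the separate generic points that
  \<open>rig_indep\<close> allows for different sets.\<close>

lemma ex_point_of_maximal_ranks:
  assumes G: "simple_graph V E"
  shows "\<exists>x\<^sub>0. alg_indep (V \<times> {..<d}) x\<^sub>0 \<and> (\<forall>S\<subseteq>E. \<forall>x.
    lin_indep (V \<times> {..<d}) (rig_row x) S \<longrightarrow> lin_indep (V \<times> {..<d}) (rig_row x\<^sub>0) S)"
proof -
  let ?I = "V \<times> {..<d}"
  let ?\<S> = "{S. S \<subseteq> E \<and> (\<exists>x. lin_indep ?I (rig_row x) S)}"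
  note fin = simple_graph_finite[OF G]
  have finI: "finite ?I" using fin by simp
  have "\<exists>D. polyfun ?I D \<and> (\<exists>x. D x \<noteq> 0) \<and> (\<forall>x. D x \<noteq> 0 \<longrightarrow> lin_indep ?I (rig_row x) S)"
    if S: "S \<in> ?\<S>" for S
  proof -
    obtain x\<^sub>0 where x0: "S \<subseteq> E" "lin_indep ?I (rig_row x\<^sub>0) S" using S by blast
    have finS: "finite S" using x0 fin finite_subset by blast
    have "polyfun ?I (\<lambda>x. rig_row x e i)" if "e \<in> S" "i \<in> ?I" for e i
      using polyfun_rig_row[OF G] x0 that by blast
    then obtain D where D: "polyfun ?I D" "D x\<^sub>0 \<noteq> 0"
      and sol: "\<forall>b. (\<forall>e\<in>S. polyfun ?I (b e)) \<longrightarrow>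
      (\<exists>u. (\<forall>k\<in>?I. polyfun ?I (u k)) \<and>
        (\<forall>x. \<forall>e\<in>S. (\<Sum>k\<in>?I. rig_row x e k * u k x) = D x * b e x))"
      using polyfun_right_inverse[of S ?I ?I "\<lambda>e i x. rig_row x e i" x\<^sub>0] finS finI x0(2) by blast
    have "lin_indep ?I (rig_row x) S" if "D x \<noteq> 0" for x
      using polyfun_right_inverse_imp_lin_indep[of S ?I ?I "\<lambda>e i x. rig_row x e i" D x, OF finS sol that]
      by simp
    then show ?thesis using D by blast
  qed
  then have "\<exists>D. \<forall>S\<in>?\<S>. polyfun ?I (D S) \<and> (\<exists>x. D S x \<noteq> 0) \<and>
      (\<forall>x. D S x \<noteq> 0 \<longrightarrow> lin_indep ?I (rig_row x) S)"
    by (intro bchoice ballI)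
  then obtain D where D: "\<And>S. S \<in> ?\<S> \<Longrightarrow> polyfun ?I (D S)"
    "\<And>S. S \<in> ?\<S> \<Longrightarrow> \<exists>x. D S x \<noteq> 0"
    "\<And>S x. S \<in> ?\<S> \<Longrightarrow> D S x \<noteq> 0 \<Longrightarrow> lin_indep ?I (rig_row x) S"
    by blast
  have "finite ?\<S>" using fin by simp
  then have "\<exists>x. \<forall>f \<in> rat_polyfuns ?I \<union> D ` ?\<S>. f x \<noteq> 0"
  proof (intro ex_common_nonzero[OF finI] countable_Un countable_rat_polyfuns finI
      countable_image countable_finite)
    fix f assume f: "f \<in> rat_polyfuns ?I \<union> D ` ?\<S>"
    show "polyfun ?I f" using f D(1) polyfun_rat_polyfuns by blast
    show "\<exists>x. f x \<noteq> 0" using f D(2) rat_polyfuns_nonzero[OF finI] by blast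
  qed
  then obtain x\<^sub>0 where x0: "\<forall>f \<in> rat_polyfuns ?I \<union> D ` ?\<S>. f x\<^sub>0 \<noteq> 0" by (rule exE)
  show ?thesis
  proof (intro exI[of _ x\<^sub>0] conjI allI impI)
    show "alg_indep ?I x\<^sub>0" using x0 by (simp add: alg_indep_iff_rat_polyfuns)
    show "lin_indep ?I (rig_row x\<^sub>0) S" if "S \<subseteq> E" "lin_indep ?I (rig_row x) S" for S x
    proof -
      have S: "S \<in> ?\<S>" using that by blast
      then have "D S x\<^sub>0 \<noteq> 0" using x0 by simp
      then show ?thesis by (rule D(3)[OF S])
    qed
  qed
qed

text \<open>The averaging argument. Put \<open>x = (p + q) / 2\<close> and \<open>h = (q - p) / 2\<close>: the squared lengths of
  an edge in \<open>p\<close> and \<open>q\<close> agree iff \<open>h\<close> is annihilated by its row of the rigidity matrix at \<open>x\<close>.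
  So it suffices to treat the edges of the basis \<open>B\<close>, and for these \<open>p\<close> solves a linear system
  whose coefficients are polynomials along a line \<open>x\<^sub>0 + t y\<close>. The resulting curve
  \<open>q = x\<^sub>0 + t z + O(t\<^sup>2)\<close> has a freely prescribed velocity \<open>z\<close>, hence contains generic points.\<close>

lemma ex_generic_length_equal_pair:
  fixes V :: "'v set" and W :: "nat set" and \<iota> :: "bool \<Rightarrow> 'v \<Rightarrow> nat"
  assumes G: "simple_graph V E" and B: "B \<subseteq> E" and finW: "finite W"
    and \<iota>: "\<And>\<sigma> v. v \<in> V \<Longrightarrow> \<pi> (\<iota> \<sigma> v) = v" "\<And>\<sigma> v. v \<in> V \<Longrightarrow> \<iota> \<sigma> v \<in> W"
    and \<pi>: "\<And>n. n \<in> W \<Longrightarrow> \<pi> n \<in> V"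
    and gen: "alg_indep (V \<times> {..<d}) x\<^sub>0"
    and indep: "lin_indep (V \<times> {..<d}) (rig_row x\<^sub>0) B"
    and dep: "\<And>e x. e \<in> E - B \<Longrightarrow>
      \<not> lin_indep (V \<times> {..<d}) (rig_row x) (insert e {b \<in> B. side b = side e})"
  shows "\<exists>p q. alg_indep (V \<times> {..<d}) p \<and> alg_indep (W \<times> {..<d}) q \<and>
    (\<forall>u v. {u, v} \<in> E \<longrightarrow>
      real_sqlen d p u v = real_sqlen d q (\<iota> (side {u, v}) u) (\<iota> (side {u, v}) v))"
proof -
  define I where "I = V \<times> {..<d}"
  define J where "J = W \<times> {..<d}"
  note fin = simple_graph_finite[OF G]
  have finI: "finite I" and finJ: "finite J" using fin finW by (auto simp: I_def J_def)
  have finB: "finite B" using B fin finite_subset by blast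
  define lin where "lin e x h = (\<Sum>i\<in>I. rig_row x e i * h i)" for e x h
  have lin1: "lin e (\<lambda>i. x i + t * y i) h = lin e x h + t * lin e y h" for e x t y h
    by (simp add: lin_def rig_row_linear algebra_simps sum.distrib sum_distrib_left)
  have lin2: "lin e x (\<lambda>i. s * h i - t * g i) = s * lin e x h - t * lin e x g" for e x s h t g
    by (simp add: lin_def algebra_simps sum_subtractf sum_distrib_left)
  define lift where "lift e x = (\<lambda>(w, k). x (\<iota> (side e) w, k))" for e and x :: "nat \<times> nat \<Rightarrow> real"
  \<comment> \<open>This is the rigidity matrix of the competitor with the columns of the two copies
    of each vertex added, because the unknown \<open>p\<close> takes the same value on both
    copies.\<close>
  define R where "R e i x = rig_row (lift e x) e i" for e i x
  have polyR: "polyfun J (R e i)" if "e \<in> E" "i \<in> I" for e i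
    unfolding R_def
  proof (rule polyfun_compose[OF polyfun_rig_row[OF G that(1) that(2)[unfolded I_def]]])
    fix j assume "j \<in> V \<times> {..<d}"
    then show "polyfun J (\<lambda>x. lift e x j)"
      using \<iota>(2) by (auto simp: lift_def J_def intro!: polyfun_coord)
  qed
  have R_eq: "R e i x = rig_row y e i"
    if "e \<in> E" "i \<in> I" "\<And>i. i \<in> I \<Longrightarrow> lift e x i = y i" for e i x y
    unfolding R_def
    by (rule polyfun_cong[OF polyfun_rig_row[OF G that(1), of i d], of "lift e x" y])
      (use that in \<open>auto simp: I_def\<close>)
  \<comment> \<open>Both copies are placed at \<open>x\<^sub>0\<close>, where \<open>R\<close> is
    the rigidity matrix of \<open>G\<close> itself.\<close>
  define X\<^sub>0 where "X\<^sub>0 = (\<lambda>(n, k). x\<^sub>0 (\<pi> n, k))"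
  have R0: "R e i X\<^sub>0 = rig_row x\<^sub>0 e i" if "e \<in> E" "i \<in> I" for e i
    by (rule R_eq) (use that \<iota> in \<open>auto simp: I_def X\<^sub>0_def lift_def\<close>)
  have "lin_indep I (\<lambda>e i. R e i X\<^sub>0) B"
    using indep lin_indep_cong[of B I "\<lambda>e i. R e i X\<^sub>0" "rig_row x\<^sub>0"] R0 B by (auto simp: I_def)
  then obtain D where D: "polyfun J D" "D X\<^sub>0 \<noteq> 0"
    and sol: "\<forall>b. (\<forall>e\<in>B. polyfun J (b e)) \<longrightarrow>
      (\<exists>u. (\<forall>k\<in>I. polyfun J (u k)) \<and>
        (\<forall>x. \<forall>e\<in>B. (\<Sum>k\<in>I. R e k x * u k x) = D x * b e x))"
    using polyfun_right_inverse[OF finB finI, of J R X\<^sub>0] polyR B by blast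

  have "\<exists>F. polyfun J F \<and> (\<exists>z. F z \<noteq> 0) \<and>
    (\<forall>z w. F z \<noteq> 0 \<longrightarrow> (\<forall>i\<in>J. ((\<lambda>t. w t i) \<longlongrightarrow> z i) (at 0)) \<longrightarrow>
      (\<forall>\<^sub>F t in at 0. g (\<lambda>i. X\<^sub>0 i + t * w t i) \<noteq> 0))" if "g \<in> rat_polyfuns J" for g
    using ex_nonvanishing_velocity[of J g X\<^sub>0] polyfun_rat_polyfuns[OF that]
      rat_polyfuns_nonzero[OF finJ that] by blast
  then have "\<exists>F. \<forall>g\<in>rat_polyfuns J. polyfun J (F g) \<and> (\<exists>z. F g z \<noteq> 0) \<and>
    (\<forall>z w. F g z \<noteq> 0 \<longrightarrow> (\<forall>i\<in>J. ((\<lambda>t. w t i) \<longlongrightarrow> z i) (at 0)) \<longrightarrow>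
      (\<forall>\<^sub>F t in at 0. g (\<lambda>i. X\<^sub>0 i + t * w t i) \<noteq> 0))"
    by (intro bchoice ballI)
  then obtain F where F: "\<And>g. g \<in> rat_polyfuns J \<Longrightarrow> polyfun J (F g)"
    "\<And>g. g \<in> rat_polyfuns J \<Longrightarrow> \<exists>z. F g z \<noteq> 0"
    "\<And>g z w. g \<in> rat_polyfuns J \<Longrightarrow> F g z \<noteq> 0 \<Longrightarrow> (\<forall>i\<in>J. ((\<lambda>t. w t i) \<longlongrightarrow> z i) (at 0)) \<Longrightarrow>
      \<forall>\<^sub>F t in at 0. g (\<lambda>i. X\<^sub>0 i + t * w t i) \<noteq> 0"
    by blast
  have "\<exists>z. \<forall>f \<in> F ` rat_polyfuns J. f z \<noteq> 0"
    using F(1,2) countable_rat_polyfuns[OF finJ] by (intro ex_common_nonzero[OF finJ]) auto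
  then obtain z where z: "\<And>g. g \<in> rat_polyfuns J \<Longrightarrow> F g z \<noteq> 0" by blast

  \<comment> \<open>\<open>s\<close> will be the velocity of \<open>p\<close>: to first order it
    changes the lengths of the basis edges exactly as \<open>z\<close> does in the
    competitor.\<close>
  have "\<exists>s. \<forall>e\<in>B. lin e x\<^sub>0 s = lin e x\<^sub>0 (lift e z)"
  proof -
    obtain u where u: "\<And>e. e \<in> B \<Longrightarrow> (\<Sum>k\<in>I. R e k X\<^sub>0 * u k X\<^sub>0) = D X\<^sub>0 * lin e x\<^sub>0 (lift e z)"
      using sol[rule_format, of "\<lambda>e _. lin e x\<^sub>0 (lift e z)", OF polyfun_const] by blast
    have "lin e x\<^sub>0 (\<lambda>i. u i X\<^sub>0 / D X\<^sub>0) = lin e x\<^sub>0 (lift e z)" if "e \<in> B" for e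
    proof -
      have "lin e x\<^sub>0 (\<lambda>i. u i X\<^sub>0 / D X\<^sub>0) = (\<Sum>k\<in>I. R e k X\<^sub>0 * u k X\<^sub>0) / D X\<^sub>0"
        unfolding lin_def sum_divide_distrib using R0 B that by (intro sum.cong) auto
      then show ?thesis using u[OF that] D(2) by simp
    qed
    then show ?thesis by blast
  qed
  then obtain s where s: "\<And>e. e \<in> B \<Longrightarrow> lin e x\<^sub>0 s = lin e x\<^sub>0 (lift e z)" by blast

  \<comment> \<open>The mean of the velocities of \<open>q\<close> and \<open>p\<close>, seen in the
    copy carrying \<open>e\<close>. Thus \<open>X\<close> is a straight line of midpoints.\<close>
  define y where "y e i = (lift e z i + s i) / 2" for e i
  define x where "x e t i = x\<^sub>0 i + t * y e i" for e t i
  define X where "X t = (\<lambda>(n, k). x\<^sub>0 (\<pi> n, k) + t * ((z (n, k) + s (\<pi> n, k)) / 2))" for t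
  have lift_X: "lift e (X t) i = x e t i" if "i \<in> I" for e t i
    using that \<iota>(1) by (auto simp: lift_def X_def x_def y_def I_def)
  have RX: "R e i (X t) = rig_row (x e t) e i" if "e \<in> E" "i \<in> I" for e i t
    by (rule R_eq[OF that lift_X])
  \<comment> \<open>By bilinearity and the choice of \<open>s\<close>, the straight line with
    velocity \<open>s\<close> violates the equation of a basis edge by exactly
    \<open>t\<^sup>2 * \<beta> e\<close>. The factors 1 fit the shape of
    \<open>lin2\<close>.\<close>
  define \<beta> where "\<beta> e = lin e (y e) (\<lambda>i. 1 * y e i - 1 * s i)" for e
  obtain u where u: "\<And>i. i \<in> I \<Longrightarrow> polyfun J (u i)"
    and u_sol: "\<And>x e. e \<in> B \<Longrightarrow> (\<Sum>i\<in>I. R e i x * u i x) = D x * \<beta> e"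
    using sol[rule_format, of "\<lambda>e _. \<beta> e", OF polyfun_const] by blast
  have curve: "\<exists>P. \<forall>t. f (X t) = poly P t" if "polyfun J f" for f
    by (rule polyfun_along_poly_curve[OF that,
          where N = "\<lambda>(n, k). [:x\<^sub>0 (\<pi> n, k), (z (n, k) + s (\<pi> n, k)) / 2:]"])
      (auto simp: X_def)
  obtain P where P: "\<And>t. D (X t) = poly P t" using curve[OF D(1)] by blast
  have "\<exists>U. \<forall>i\<in>I. \<forall>t. u i (X t) = poly (U i) t"
    by (intro bchoice ballI curve u)
  then obtain U where U: "\<And>i t. i \<in> I \<Longrightarrow> u i (X t) = poly (U i) t" by blast
  have X0: "X 0 = X\<^sub>0" by (simp add: X_def X\<^sub>0_def)
  have P0: "poly P 0 \<noteq> 0" using P[of 0] X0 D(2) by simp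

  \<comment> \<open>The correction cancels this defect. Being of order two with a denominator
    nonzero at \<open>t = 0\<close>, it leaves the velocities \<open>s\<close> of \<open>p\<close>
    and \<open>z\<close> of \<open>q\<close> unchanged there.\<close>
  define p where "p t i = x\<^sub>0 i + t * s i + t\<^sup>2 * (u i (X t) / D (X t))" for t i
  define q where "q t = (\<lambda>(n, k). 2 * X t (n, k) - p t (\<pi> n, k))" for t
  define w where "w t = (\<lambda>(n, k). z (n, k) - t * (u (\<pi> n, k) (X t) / D (X t)))" for t
  have q_w: "q t = (\<lambda>i. X\<^sub>0 i + t * w t i)" for t
    by (auto simp: q_def w_def X\<^sub>0_def X_def p_def fun_eq_iff algebra_simps power2_eq_square)
  have U_eq: "u i (X t) / D (X t) * poly P t = poly (U i) t" if "i \<in> I" "poly P t \<noteq> 0" for i t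
    using that U P by simp
  have \<pi>I: "(\<pi> n, k) \<in> I" if "(n, k) \<in> J" for n k using that \<pi> by (auto simp: I_def J_def)

  have lin_x_B: "lin e (x e t) (\<lambda>i. x e t i - p t i) = 0" if e: "e \<in> B" and t: "poly P t \<noteq> 0" for e t
  proof -
    let ?v = "\<lambda>i. 1 * y e i - 1 * s i"
    have "lin e x\<^sub>0 ?v = lin e x\<^sub>0 (\<lambda>i. (1/2) * lift e z i - (1/2) * s i)"
      by (simp add: y_def field_simps)
    then have v0: "lin e x\<^sub>0 ?v = 0" unfolding lin2 using s[OF e] by simp
    have "lin e (x e t) (\<lambda>i. u i (X t) / D (X t)) = (\<Sum>i\<in>I. R e i (X t) * u i (X t)) / D (X t)"
      unfolding lin_def sum_divide_distrib using RX B e by (intro sum.cong) auto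
    also have "\<dots> = \<beta> e" using u_sol[OF e] t P by simp
    finally have uU: "lin e (x e t) (\<lambda>i. u i (X t) / D (X t)) = \<beta> e" .
    have "(\<lambda>i. x e t i - p t i) = (\<lambda>i. t * ?v i - t\<^sup>2 * (u i (X t) / D (X t)))"
      by (auto simp: x_def p_def algebra_simps)
    then have "lin e (x e t) (\<lambda>i. x e t i - p t i) = t * lin e (x e t) ?v - t\<^sup>2 * \<beta> e"
      by (simp only: lin2 uU)
    also have "lin e (x e t) ?v = lin e x\<^sub>0 ?v + t * \<beta> e"
      unfolding x_def \<beta>_def by (rule lin1)
    finally show ?thesis using v0 by (simp add: power2_eq_square)
  qed
  have lin_x_E: "lin e (x e t) (\<lambda>i. x e t i - p t i) = 0" if e: "e \<in> E" and t: "poly P t \<noteq> 0" for e t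
  proof (cases "e \<in> B")
    case True
    then show ?thesis using lin_x_B t by blast
  next
    case False
    let ?B = "{b \<in> B. side b = side e}" and ?h = "\<lambda>i. x e t i - p t i"
    \<comment> \<open>Basis edges on the side of \<open>e\<close> see the same copy, so the
      dependency of \<open>e\<close> on them transfers their equations to \<open>e\<close>.\<close>
    have x_side: "x b t = x e t" if "b \<in> ?B" for b
      using that by (auto simp: x_def y_def lift_def fun_eq_iff)
    have "lin_indep I (\<lambda>e i. R e i (X t)) B"
      using polyfun_right_inverse_imp_lin_indep[of B J I R D "X t", OF finB sol] t P by simp
    then have "lin_indep I (\<lambda>e i. R e i (X t)) ?B"
      by (rule lin_indep_subset) (use finB in auto)
    moreover have "R b i (X t) = rig_row (x e t) b i" if "b \<in> ?B" "i \<in> I" for b i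
      using RX[of b i t] x_side[OF that(1)] that B by auto
    ultimately have indB: "lin_indep I (rig_row (x e t)) ?B"
      using lin_indep_cong[of ?B I "\<lambda>e i. R e i (X t)" "rig_row (x e t)"] by blast
    obtain c g where c: "\<And>i. i \<in> I \<Longrightarrow> (\<Sum>g\<in>insert e ?B. c g * rig_row (x e t) g i) = 0"
      and g: "g \<in> insert e ?B" "c g \<noteq> 0"
      using dep[of e "x e t"] e False unfolding lin_indep_def I_def by blast
    have c': "c e * rig_row (x e t) e i + (\<Sum>g\<in>?B. c g * rig_row (x e t) g i) = 0" if "i \<in> I" for i
      using c[OF that] finB False by simp
    have "c e \<noteq> 0"
    proof
      assume c0: "c e = 0"
      then have "g \<in> ?B" using g by auto
      moreover have "(\<Sum>g\<in>?B. c g * rig_row (x e t) g i) = 0" if "i \<in> I" for i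
        using c'[OF that] c0 by simp
      ultimately have "c g = 0" using lin_indepD[OF indB, of c g] by blast
      then show False using g by simp
    qed
    have "0 = (\<Sum>i\<in>I. (c e * rig_row (x e t) e i + (\<Sum>g\<in>?B. c g * rig_row (x e t) g i)) * ?h i)"
      using c' by simp
    also have "\<dots> = c e * lin e (x e t) ?h + (\<Sum>i\<in>I. \<Sum>g\<in>?B. c g * (rig_row (x e t) g i * ?h i))"
      unfolding lin_def
      by (simp add: distrib_right sum.distrib sum_distrib_left sum_distrib_right mult.assoc)
    also have "(\<Sum>i\<in>I. \<Sum>g\<in>?B. c g * (rig_row (x e t) g i * ?h i)) =
        (\<Sum>g\<in>?B. c g * lin g (x e t) ?h)"
      unfolding lin_def by (subst sum.swap) (simp add: sum_distrib_left)
    also have "\<dots> = 0"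
    proof (rule sum.neutral, rule ballI)
      fix b assume b: "b \<in> ?B"
      then show "c b * lin b (x e t) ?h = 0"
        using lin_x_B[of b t] t x_side[OF b] by simp
    qed
    finally show ?thesis using \<open>c e \<noteq> 0\<close> by simp
  qed
  have len: "real_sqlen d (p t) a b = real_sqlen d (q t) (\<iota> (side {a, b}) a) (\<iota> (side {a, b}) b)"
    if e: "{a, b} \<in> E" and t: "poly P t \<noteq> 0" for a b t
  proof -
    let ?e = "{a, b}"
    have ab: "a \<noteq> b" "a \<in> V" "b \<in> V"
      using simple_graph_edge[OF G e] by (metis doubleton_eq_iff)+
    have q_lift: "q t (\<iota> (side ?e) v, k) = 2 * x ?e t (v, k) - p t (v, k)" if "v \<in> V" "k < d" for v k
      using lift_X[of "(v, k)" ?e t] \<iota>(1)[OF that(1)] that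
      by (auto simp: q_def lift_def I_def)
    \<comment> \<open>For coordinate differences \<open>X\<close> of the midpoint and
      \<open>P\<close> of \<open>p\<close> this is
      \<open>(2 * X - P)\<^sup>2 - P\<^sup>2 = 4 * X * (X - P)\<close>.\<close>
    have "real_sqlen d (q t) (\<iota> (side ?e) a) (\<iota> (side ?e) b) - real_sqlen d (p t) a b =
        (\<Sum>k<d. 4 * ((x ?e t (a, k) - x ?e t (b, k)) *
          ((x ?e t (a, k) - p t (a, k)) - (x ?e t (b, k) - p t (b, k)))))"
      unfolding real_sqlen_def sum_subtractf[symmetric]
      by (intro sum.cong) (auto simp: q_lift ab power2_eq_square algebra_simps)
    also have "\<dots> = 4 * lin ?e (x ?e t) (\<lambda>i. x ?e t i - p t i)"
      unfolding lin_def I_def sum_rig_row[OF fin(1) ab] by (simp add: sum_distrib_left)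
    finally show ?thesis using lin_x_E[OF e t] by simp
  qed

  have finP: "finite {t. poly P t = 0}" using P0 by (intro poly_roots_finite) auto
  have fin_p: "finite {t. poly P t \<noteq> 0 \<and> f (p t) = 0}" if f: "f \<in> rat_polyfuns I" for f
  proof (rule finite_zeros_along_rational_curve[of I f P p
        "\<lambda>i. [:x\<^sub>0 i, s i:] * P + [:0, 0, 1:] * U i", OF polyfun_rat_polyfuns[OF f] _ P0])
    show "p t i * poly P t = poly ([:x\<^sub>0 i, s i:] * P + [:0, 0, 1:] * U i) t"
      if "i \<in> I" "poly P t \<noteq> 0" for i t
      using U_eq[OF that, symmetric] by (simp add: p_def algebra_simps power2_eq_square)
    have "p 0 = x\<^sub>0" by (simp add: p_def fun_eq_iff)
    then show "f (p 0) \<noteq> 0" using gen f by (simp add: alg_indep_iff_rat_polyfuns I_def)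
  qed
  \<comment> \<open>Unlike \<open>p 0 = x\<^sub>0\<close>, the point \<open>q 0\<close> makes both
    copies of a vertex coincide and need not be a nonzero of \<open>g\<close>. The velocity
    \<open>z\<close> supplies a nonzero at a nearby parameter instead.\<close>
  have fin_q: "finite {t. poly P t \<noteq> 0 \<and> g (q t) = 0}" if g: "g \<in> rat_polyfuns J" for g
  proof -
    have "((\<lambda>t. w t i) \<longlongrightarrow> z i) (at 0)" if "i \<in> J" for i
    proof -
      obtain n k where i: "i = (n, k)" by (cases i)
      have "((\<lambda>t. z (n, k) - t * (poly (U (\<pi> n, k)) t / poly P t)) \<longlongrightarrow>
          z (n, k) - 0 * (poly (U (\<pi> n, k)) 0 / poly P 0)) (at 0)"
        by (intro tendsto_intros isContD[OF poly_isCont] P0)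
      then show ?thesis using that \<pi>I by (simp add: i w_def U P)
    qed
    then have "\<forall>\<^sub>F t in at 0. g (q t) \<noteq> 0" unfolding q_w using F(3)[OF g z[OF g]] by blast
    moreover have "\<forall>\<^sub>F t in at 0. poly P t \<noteq> 0"
      by (rule tendsto_imp_eventually_ne[OF isContD[OF poly_isCont] P0])
    ultimately have "\<forall>\<^sub>F t in at 0. g (q t) \<noteq> 0 \<and> poly P t \<noteq> 0" by (rule eventually_conj)
    then obtain t\<^sub>0 where t0: "g (q t\<^sub>0) \<noteq> 0" "poly P t\<^sub>0 \<noteq> 0"
      using eventually_happens'[OF at_neq_bot] by blast
    show ?thesis
    proof (rule finite_zeros_along_rational_curve[of J g P q
          "\<lambda>(n, k). [:x\<^sub>0 (\<pi> n, k), z (n, k):] * P - [:0, 0, 1:] * U (\<pi> n, k)",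
          OF polyfun_rat_polyfuns[OF g] _ t0(2,1)])
      show "q t i * poly P t =
          poly ((\<lambda>(n, k). [:x\<^sub>0 (\<pi> n, k), z (n, k):] * P - [:0, 0, 1:] * U (\<pi> n, k)) i) t"
        if "i \<in> J" "poly P t \<noteq> 0" for i t
      proof -
        obtain n k where i: "i = (n, k)" by (cases i)
        show ?thesis
          using U_eq[of "(\<pi> n, k)" t, symmetric] that \<pi>I[of n k]
          by (simp add: i q_w X\<^sub>0_def w_def algebra_simps)
      qed
    qed
  qed
  let ?Z = "{t. poly P t = 0} \<union> (\<Union>f\<in>rat_polyfuns I. {t. poly P t \<noteq> 0 \<and> f (p t) = 0}) \<union>
    (\<Union>g\<in>rat_polyfuns J. {t. poly P t \<noteq> 0 \<and> g (q t) = 0})"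
  have "countable ?Z"
    by (intro countable_Un countable_UN countable_rat_polyfuns finI finJ countable_finite
        finP fin_p fin_q)
  then have "?Z \<noteq> UNIV" using uncountable_UNIV_real by metis
  then obtain t where "t \<notin> ?Z" by blast
  then have t: "poly P t \<noteq> 0" "\<forall>f\<in>rat_polyfuns I. f (p t) \<noteq> 0" "\<forall>g\<in>rat_polyfuns J. g (q t) \<noteq> 0"
    by auto
  show ?thesis
  proof (intro exI[of _ "p t"] exI[of _ "q t"] conjI allI impI)
    show "alg_indep (V \<times> {..<d}) (p t)" "alg_indep (W \<times> {..<d}) (q t)"
      using t(2,3) by (simp_all add: alg_indep_iff_rat_polyfuns I_def J_def)
  qed (rule len[OF _ t(1)])
qed

section \<open>Competing frameworks\<close>

text \<open>Needed because \<open>W\<close> may contain points on no edge of the competitor, whose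
  vertex set is only \<open>\<Union>F\<close>.\<close>

lemma alg_indep_subset:
  assumes "alg_indep I x" "J \<subseteq> I" "finite I"
  shows "alg_indep J x"
  unfolding alg_indep_def
proof (intro allI impI)
  fix M :: "('a \<Rightarrow> nat) set" and c
  assume M: "finite M \<and> (\<forall>m\<in>M. \<forall>i. i \<notin> J \<longrightarrow> m i = 0) \<and>
    (\<Sum>m\<in>M. of_rat (c m) * (\<Prod>i\<in>J. x i ^ m i)) = 0"
  have "(\<Prod>i\<in>I. x i ^ m i) = (\<Prod>i\<in>J. x i ^ m i)" if "m \<in> M" for m
    using assms(2,3) M that by (intro prod.mono_neutral_right) auto
  then have "(\<Sum>m\<in>M. of_rat (c m) * (\<Prod>i\<in>I. x i ^ m i)) = 0"
    using M by (metis (mono_tags, lifting) sum.cong)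
  moreover have "\<forall>m\<in>M. \<forall>i. i \<notin> I \<longrightarrow> m i = 0" using M assms(2) by blast
  ultimately show "\<forall>m\<in>M. c m = 0" using assms(1) M unfolding alg_indep_def by blast
qed

text \<open>The correspondence \<open>\<psi>\<close> is induced by an injective
  \<open>\<phi>\<close>, which preserves disjointness of edges. Since \<open>\<iota>\<close> may
  depend on the edge it can split a vertex, and since it is injective only on single edges it can
  merge vertices.\<close>

lemma reconstructible_edges_disjoint:
  fixes V :: "'v set" and \<iota> :: "'v set \<Rightarrow> 'v \<Rightarrow> nat"
  assumes G: "simple_graph V E" and rec: "fully_reconstructible d V E"
    and p: "alg_indep (V \<times> {..<d}) p"
    and q: "alg_indep (W \<times> {..<d}) q" "finite W"
    and inj: "inj_on (\<lambda>e. \<iota> e ` e) E" "\<And>e. e \<in> E \<Longrightarrow> inj_on (\<iota> e) e"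
    and W: "\<And>e. e \<in> E \<Longrightarrow> \<iota> e ` e \<subseteq> W"
    and len: "\<And>u v. {u, v} \<in> E \<Longrightarrow>
      real_sqlen d p u v = real_sqlen d q (\<iota> {u, v} u) (\<iota> {u, v} v)"
    and e: "e\<^sub>1 \<in> E" "e\<^sub>2 \<in> E"
  shows "e\<^sub>1 \<inter> e\<^sub>2 = {} \<longleftrightarrow> \<iota> e\<^sub>1 ` e\<^sub>1 \<inter> \<iota> e\<^sub>2 ` e\<^sub>2 = {}"
proof -
  define \<psi> where "\<psi> e = \<iota> e ` e" for e
  define F where "F = \<psi> ` E"
  define p' where "p' = curry (\<lambda>i. complex_of_real (p i))"
  define q' where "q' = curry (\<lambda>i. complex_of_real (q i))"
  have FW: "\<Union>F \<subseteq> W" using W by (auto simp: F_def \<psi>_def)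
  have "generic d V p'"
    unfolding p'_def generic_def using alg_indep_of_real[OF p]
    by (simp add: case_prod_unfold)
  then have rec': "fully_reconstructible_fw d V E p'"
    using rec by (simp add: fully_reconstructible_def)
  have "finite (\<Union>F)" using FW q(2) finite_subset by blast
  moreover have "card f = 2" if "f \<in> F" for f
    using that G inj(2) by (auto simp: F_def \<psi>_def simple_graph_def card_image)
  ultimately have "simple_graph (\<Union>F) F" by (auto simp: simple_graph_def)
  moreover have "generic d (\<Union>F) q'"
  proof -
    have "alg_indep (\<Union>F \<times> {..<d}) q"
      using q FW by (intro alg_indep_subset[OF q(1)]) auto
    from alg_indep_of_real[OF this] show ?thesis
      unfolding q'_def generic_def by (simp add: case_prod_unfold)
  qed
  moreover have "length_equiv d E p' F q' \<psi>"
    unfolding length_equiv_def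
  proof (intro conjI allI impI)
    show "bij_betw \<psi> E F" using inj(1) unfolding F_def bij_betw_def \<psi>_def by simp
    fix u v a b assume uv: "{u, v} \<in> E" and ab: "\<psi> {u, v} = {a, b}"
    have sq: "sqlen d p' u v = complex_of_real (real_sqlen d p u v)"
      "sqlen d q' a b = complex_of_real (real_sqlen d q a b)" for a b
      by (simp_all add: sqlen_def real_sqlen_def p'_def q'_def)
    have "{\<iota> {u, v} u, \<iota> {u, v} v} = {a, b}" using ab by (simp add: \<psi>_def)
    then have "real_sqlen d q a b = real_sqlen d q (\<iota> {u, v} u) (\<iota> {u, v} v)"
      by (auto simp: doubleton_eq_iff real_sqlen_def power2_commute)
    then show "sqlen d p' u v = sqlen d q' a b" using len[OF uv] by (simp add: sq)
  qed
  ultimately obtain \<phi> where \<phi>: "bij_betw \<phi> V (\<Union>F)"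
    "\<And>u v. {u, v} \<in> E \<Longrightarrow> \<psi> {u, v} = {\<phi> u, \<phi> v}"
    using rec' unfolding fully_reconstructible_fw_def by blast
  have "\<psi> e = \<phi> ` e" if eE: "e \<in> E" for e
  proof -
    obtain u v where "e = {u, v}" using simple_graph_edge[OF G eE] by metis
    then show ?thesis using \<phi>(2)[of u v] eE by simp
  qed
  moreover have "e\<^sub>1 \<subseteq> V" "e\<^sub>2 \<subseteq> V" using G e by (auto simp: simple_graph_def)
  then have "\<phi> ` e\<^sub>1 \<inter> \<phi> ` e\<^sub>2 = \<phi> ` (e\<^sub>1 \<inter> e\<^sub>2)"
    using inj_on_image_Int[of \<phi> V e\<^sub>1 e\<^sub>2] \<phi>(1) by (simp add: bij_betw_def)
  ultimately show ?thesis using e unfolding \<psi>_def by simp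
qed

text \<open>If two sets of edges share no vertex, translating one of them until a vertex \<open>b\<close> of it
  meets a vertex \<open>a\<close> of the other preserves all lengths.\<close>

lemma reconstructible_not_disjoint:
  fixes V :: "'v set"
  assumes G: "simple_graph V E" and rec: "fully_reconstructible d V E"
    and E\<^sub>1: "E\<^sub>1 \<subseteq> E" "E\<^sub>1 \<noteq> {}" "E - E\<^sub>1 \<noteq> {}"
  shows "\<Union>E\<^sub>1 \<inter> \<Union>(E - E\<^sub>1) \<noteq> {}"
proof
  assume disj: "\<Union>E\<^sub>1 \<inter> \<Union>(E - E\<^sub>1) = {}"
  define V\<^sub>2 where "V\<^sub>2 = \<Union>(E - E\<^sub>1)"
  note fin = simple_graph_finite[OF G]
  have EV: "e \<subseteq> V" "card e = 2" if "e \<in> E" for e using G that by (auto simp: simple_graph_def)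
  obtain e\<^sub>1 e\<^sub>2 where e: "e\<^sub>1 \<in> E\<^sub>1" "e\<^sub>2 \<in> E - E\<^sub>1" using E\<^sub>1 by blast
  have "e\<^sub>1 \<noteq> {}" "e\<^sub>2 \<noteq> {}" using EV e E\<^sub>1 by force+
  then obtain a b where ab: "a \<in> e\<^sub>1" "b \<in> e\<^sub>2" by blast
  have side1: "v \<notin> V\<^sub>2" if "v \<in> e" "e \<in> E\<^sub>1" for v e using that disj by (auto simp: V\<^sub>2_def)
  have side2: "v \<in> V\<^sub>2" if "v \<in> e" "e \<in> E" "e \<notin> E\<^sub>1" for v e using that by (auto simp: V\<^sub>2_def)
  have a: "a \<in> V" "a \<notin> V\<^sub>2" using side1 ab e E\<^sub>1 EV by blast+
  have b: "b \<in> V" "b \<in> V\<^sub>2" using side2 ab e EV by blast+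
  obtain \<eta> :: "'v \<Rightarrow> nat" where \<eta>: "inj_on \<eta> V"
    using finite_imp_inj_to_nat_seg[OF fin(1)] by blast
  define \<sigma> where "\<sigma> v = (if v = b then a else v)" for v
  define W where "W = \<eta> ` (V - {b})"
  define \<pi> where "\<pi> = inv_into V \<eta>"
  have \<pi>: "\<pi> (\<eta> v) = v" if "v \<in> V" for v using that \<eta> by (simp add: \<pi>_def)
  let ?I = "V \<times> {..<d}" and ?J = "W \<times> {..<d}"
  have finI: "finite ?I" and finJ: "finite ?J" using fin by (auto simp: W_def)
  define L :: "('v \<times> nat \<Rightarrow> real) \<Rightarrow> nat \<times> nat \<Rightarrow> real" where
    "L x = (\<lambda>(n, k). x (\<pi> n, k) + (if \<pi> n \<in> V\<^sub>2 then x (a, k) - x (b, k) else 0))" for x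
  have polyL: "polyfun ?I (\<lambda>x. g (L x))" if g: "g \<in> rat_polyfuns ?J" for g
  proof (rule polyfun_compose[OF polyfun_rat_polyfuns[OF g]])
    fix j assume "j \<in> ?J"
    then obtain v k where j: "j = (\<eta> v, k)" "v \<in> V" "k < d" by (auto simp: W_def)
    show "polyfun ?I (\<lambda>x. L x j)"
      by (cases "v \<in> V\<^sub>2")
        (use j a b \<pi> in \<open>auto simp: L_def intro!: polyfun_add polyfun_diff polyfun_coord\<close>)
  qed
  have nzL: "\<exists>x. g (L x) \<noteq> 0" if g: "g \<in> rat_polyfuns ?J" for g
  proof -
    obtain y where y: "g y \<noteq> 0" using rat_polyfuns_nonzero[OF finJ g] by blast
    \<comment> \<open>Placing \<open>b\<close> at the position of \<open>a\<close> makes the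
      translation zero, so every \<open>y\<close> is attained and \<open>g\<close> composed with
      \<open>L\<close> is a nonzero function.\<close>
    have "L (\<lambda>(v, k). y (\<eta> (\<sigma> v), k)) i = y i" if iJ: "i \<in> ?J" for i
    proof -
      obtain v k where i: "i = (\<eta> v, k)" "v \<in> V" "v \<noteq> b" using iJ by (auto simp: W_def)
      then show ?thesis by (simp add: L_def \<pi> \<sigma>_def)
    qed
    then have "g (L (\<lambda>(v, k). y (\<eta> (\<sigma> v), k))) = g y"
      using polyfun_cong[OF polyfun_rat_polyfuns[OF g], of "L (\<lambda>(v, k). y (\<eta> (\<sigma> v), k))" y] by blast
    then show ?thesis using y by metis
  qed
  have "\<exists>x. \<forall>f \<in> rat_polyfuns ?I \<union> (\<lambda>g x. g (L x)) ` rat_polyfuns ?J. f x \<noteq> 0"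
  proof (intro ex_common_nonzero[OF finI] countable_Un countable_rat_polyfuns finI finJ countable_image)
    fix f assume f: "f \<in> rat_polyfuns ?I \<union> (\<lambda>g x. g (L x)) ` rat_polyfuns ?J"
    show "polyfun ?I f" using f polyL polyfun_rat_polyfuns by (elim UnE imageE) auto
    show "\<exists>x. f x \<noteq> 0" using f nzL rat_polyfuns_nonzero[OF finI] by (elim UnE imageE) auto
  qed
  then obtain x where x: "\<forall>f \<in> rat_polyfuns ?I \<union> (\<lambda>g x. g (L x)) ` rat_polyfuns ?J. f x \<noteq> 0"
    by (rule exE)
  have \<sigma>V: "\<sigma> v \<in> V - {b}" if "v \<in> V" for v using that a b by (auto simp: \<sigma>_def)
  have \<sigma>_id: "\<sigma> ` e = e" if "e \<in> E\<^sub>1" for e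
  proof -
    have "b \<notin> e" using side1 that b(2) by blast
    then have "\<sigma> ` e = (\<lambda>v. v) ` e" by (intro image_cong) (auto simp: \<sigma>_def)
    then show ?thesis by simp
  qed
  have inj_\<sigma>: "inj_on \<sigma> e" if "e \<in> E" for e
    using side1[of _ e] side2[of _ e] that a b by (cases "e \<in> E\<^sub>1") (auto simp: inj_on_def \<sigma>_def)
  have "e\<^sub>1 \<inter> e\<^sub>2 = {} \<longleftrightarrow> (\<eta> \<circ> \<sigma>) ` e\<^sub>1 \<inter> (\<eta> \<circ> \<sigma>) ` e\<^sub>2 = {}"
  proof (rule reconstructible_edges_disjoint[OF G rec, where p = x and W = W and q = "L x"
        and \<iota> = "\<lambda>_. \<eta> \<circ> \<sigma>"])
    show "alg_indep ?I x" "alg_indep ?J (L x)"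
      using x by (simp_all add: alg_indep_iff_rat_polyfuns ball_Un)
    show "finite W" using fin by (simp add: W_def)
    show "e\<^sub>1 \<in> E" "e\<^sub>2 \<in> E" using e E\<^sub>1 by auto
    fix e assume eE: "e \<in> E"
    show "inj_on (\<eta> \<circ> \<sigma>) e"
      using EV[OF eE] \<sigma>V by (intro comp_inj_on inj_\<sigma> eE inj_on_subset[OF \<eta>]) auto
    show "(\<eta> \<circ> \<sigma>) ` e \<subseteq> W" using EV[OF eE] \<sigma>V by (auto simp: W_def)
  next
    show "inj_on (\<lambda>e. (\<eta> \<circ> \<sigma>) ` e) E"
    proof (rule inj_onI)
      fix e e' assume ee: "e \<in> E" "e' \<in> E" and "(\<eta> \<circ> \<sigma>) ` e = (\<eta> \<circ> \<sigma>) ` e'"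
      then have eq: "\<eta> ` (\<sigma> ` e) = \<eta> ` (\<sigma> ` e')" by (simp only: image_comp)
      have "\<sigma> ` e \<subseteq> V" "\<sigma> ` e' \<subseteq> V" using EV ee \<sigma>V by blast+
      from inj_on_image_eq_iff[OF \<eta> this] eq have \<sigma>: "\<sigma> ` e = \<sigma> ` e'" by (rule iffD1)
      \<comment> \<open>After gluing, edges from different parts can share only the vertex
        \<open>a\<close>, so they cannot coincide.\<close>
      have cross: False if "e \<in> E\<^sub>1" "e' \<in> E - E\<^sub>1" "\<sigma> ` e = \<sigma> ` e'" for e e'
      proof -
        have "v = a" if v: "v \<in> e" for v
        proof -
          have "v \<in> \<sigma> ` e'" using v \<sigma>_id[OF \<open>e \<in> E\<^sub>1\<close>] \<open>\<sigma> ` e = \<sigma> ` e'\<close> by simp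
          then obtain w where w: "w \<in> e'" "v = \<sigma> w" by blast
          then have "w \<in> V\<^sub>2" using side2 \<open>e' \<in> E - E\<^sub>1\<close> by blast
          then show ?thesis using w side1[OF v \<open>e \<in> E\<^sub>1\<close>] by (auto simp: \<sigma>_def split: if_splits)
        qed
        then have "e \<subseteq> {a}" by blast
        then have "card e \<le> 1" using card_mono[of "{a}" e] by simp
        moreover have "card e = 2" using EV(2) that(1) E\<^sub>1(1) by blast
        ultimately show False by simp
      qed
      show "e = e'"
      proof (cases "e \<in> E\<^sub>1"; cases "e' \<in> E\<^sub>1")
        assume "e \<in> E\<^sub>1" "e' \<in> E\<^sub>1"
        then show ?thesis using \<sigma> \<sigma>_id by simp
      next
        assume n: "e \<notin> E\<^sub>1" "e' \<notin> E\<^sub>1"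
        have "inj_on \<sigma> V\<^sub>2" using a by (auto simp: inj_on_def \<sigma>_def)
        moreover have "e \<subseteq> V\<^sub>2" "e' \<subseteq> V\<^sub>2" using n side2 ee by blast+
        ultimately show ?thesis using \<sigma> by (simp add: inj_on_image_eq_iff)
      next
        assume "e \<in> E\<^sub>1" "e' \<notin> E\<^sub>1"
        then show ?thesis using cross[of e e'] \<sigma> ee by simp
      next
        assume "e \<notin> E\<^sub>1" "e' \<in> E\<^sub>1"
        then show ?thesis using cross[of e' e] \<sigma> ee by simp
      qed
    qed
  next
    fix u v assume uv: "{u, v} \<in> E"
    \<comment> \<open>The translation is constant on each edge and cancels in coordinate
      differences.\<close>
    define c where "c k = (if {u, v} \<in> E\<^sub>1 then 0 else x (a, k) - x (b, k))" for k
    have "L x ((\<eta> \<circ> \<sigma>) w, k) = x (w, k) + c k" if w: "w \<in> {u, v}" for w k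
    proof -
      have "w \<in> V" using EV[OF uv] w by blast
      then show ?thesis
        using a b side1[OF w] side2[OF w uv] by (auto simp: L_def \<pi> \<sigma>_def c_def)
    qed
    then show "real_sqlen d x u v = real_sqlen d (L x) ((\<eta> \<circ> \<sigma>) u) ((\<eta> \<circ> \<sigma>) v)"
      by (simp add: real_sqlen_def)
  qed
  moreover have "e\<^sub>1 \<inter> e\<^sub>2 = {}" using disj e by blast
  moreover have "(\<eta> \<circ> \<sigma>) a = (\<eta> \<circ> \<sigma>) b" by (simp add: \<sigma>_def)
  then have "(\<eta> \<circ> \<sigma>) a \<in> (\<eta> \<circ> \<sigma>) ` e\<^sub>1 \<inter> (\<eta> \<circ> \<sigma>) ` e\<^sub>2" using ab by (metis IntI imageI)
  ultimately show False by blast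
qed

text \<open>By separability, bases of the two parts together form an independent set, while every
  other edge depends on the basis of its own part. This permits splitting the shared vertices, after
  which two edges that met in \<open>G\<close> become disjoint.\<close>

lemma reconstructible_not_separable:
  fixes V :: "'v set"
  assumes G: "simple_graph V E" and rec: "fully_reconstructible d V E"
    and E\<^sub>1: "E\<^sub>1 \<subseteq> E" "\<Union>E\<^sub>1 \<inter> \<Union>(E - E\<^sub>1) \<noteq> {}"
    and gen: "alg_indep (V \<times> {..<d}) x\<^sub>0"
    and max: "\<And>S x. S \<subseteq> E \<Longrightarrow> lin_indep (V \<times> {..<d}) (rig_row x) S \<Longrightarrow>
      lin_indep (V \<times> {..<d}) (rig_row x\<^sub>0) S"
    and sep: "\<And>c k. (\<And>k. k \<in> V \<times> {..<d} \<Longrightarrow> (\<Sum>e\<in>E. c e * rig_row x\<^sub>0 e k) = 0) \<Longrightarrow>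
      k \<in> V \<times> {..<d} \<Longrightarrow> (\<Sum>e\<in>E\<^sub>1. c e * rig_row x\<^sub>0 e k) = 0"
  shows False
proof -
  note fin = simple_graph_finite[OF G]
  let ?I = "V \<times> {..<d}"
  define side where "side e \<longleftrightarrow> e \<in> E\<^sub>1" for e
  have fin12: "finite E\<^sub>1" "finite (E - E\<^sub>1)" using fin E\<^sub>1 finite_subset by auto
  obtain B\<^sub>1 where B1: "B\<^sub>1 \<subseteq> E\<^sub>1" "lin_indep ?I (rig_row x\<^sub>0) B\<^sub>1"
    "\<And>e. e \<in> E\<^sub>1 - B\<^sub>1 \<Longrightarrow> \<not> lin_indep ?I (rig_row x\<^sub>0) (insert e B\<^sub>1)"
    using ex_maximal_lin_indep[OF fin12(1), of ?I "rig_row x\<^sub>0"] by blast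
  obtain B\<^sub>2 where B2: "B\<^sub>2 \<subseteq> E - E\<^sub>1" "lin_indep ?I (rig_row x\<^sub>0) B\<^sub>2"
    "\<And>e. e \<in> (E - E\<^sub>1) - B\<^sub>2 \<Longrightarrow> \<not> lin_indep ?I (rig_row x\<^sub>0) (insert e B\<^sub>2)"
    using ex_maximal_lin_indep[OF fin12(2), of ?I "rig_row x\<^sub>0"] by blast
  define B where "B = B\<^sub>1 \<union> B\<^sub>2"
  have BE: "B \<subseteq> E" using B1 B2 E\<^sub>1 by (auto simp: B_def)
  have finB: "finite B\<^sub>1" "finite B\<^sub>2" using B1(1) B2(1) fin12 finite_subset by blast+
  \<comment> \<open>Extended by zero to \<open>E\<close>, a dependency on \<open>B\<close> restricts
    to the first part by \<open>sep\<close>, and by subtraction to the second.\<close>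
  have indep: "lin_indep ?I (rig_row x\<^sub>0) B"
  proof (rule lin_indepI)
    fix c e assume c: "\<And>k. k \<in> ?I \<Longrightarrow> (\<Sum>e\<in>B. c e * rig_row x\<^sub>0 e k) = 0" and e: "e \<in> B"
    define c' where "c' e = (if e \<in> B then c e else 0)" for e
    have "(\<Sum>e\<in>E. c' e * rig_row x\<^sub>0 e k) = (\<Sum>e\<in>B. c e * rig_row x\<^sub>0 e k)" for k
      using fin BE by (intro sum.mono_neutral_cong_right) (auto simp: c'_def)
    then have "(\<Sum>e\<in>E\<^sub>1. c' e * rig_row x\<^sub>0 e k) = 0" if "k \<in> ?I" for k
      using sep[of c' k] c that by simp
    moreover have "(\<Sum>e\<in>E\<^sub>1. c' e * rig_row x\<^sub>0 e k) = (\<Sum>e\<in>B\<^sub>1. c e * rig_row x\<^sub>0 e k)" for k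
      using fin12 B1(1) B2(1) by (intro sum.mono_neutral_cong_right) (auto simp: c'_def B_def)
    ultimately have s1: "(\<Sum>e\<in>B\<^sub>1. c e * rig_row x\<^sub>0 e k) = 0" if "k \<in> ?I" for k
      using that by simp
    have "(\<Sum>e\<in>B. c e * rig_row x\<^sub>0 e k) =
        (\<Sum>e\<in>B\<^sub>1. c e * rig_row x\<^sub>0 e k) + (\<Sum>e\<in>B\<^sub>2. c e * rig_row x\<^sub>0 e k)" for k
      unfolding B_def using finB B1(1) B2(1) by (intro sum.union_disjoint) auto
    then have s2: "(\<Sum>e\<in>B\<^sub>2. c e * rig_row x\<^sub>0 e k) = 0" if "k \<in> ?I" for k
      using c[OF that] s1[OF that] by simp
    show "c e = 0"
      using e lin_indepD[OF B1(2), of c e] lin_indepD[OF B2(2), of c e] s1 s2 by (auto simp: B_def)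
  qed
  \<comment> \<open>All ranks are maximal at \<open>x\<^sub>0\<close>, so a set dependent there is
    dependent everywhere. This is required at every \<open>x\<close>, since the copies move away
    from \<open>x\<^sub>0\<close>.\<close>
  have dep: "\<not> lin_indep ?I (rig_row x) (insert e {b \<in> B. side b = side e})"
    if e: "e \<in> E - B" for e x
  proof -
    have "{b \<in> B. side b = side e} = (if e \<in> E\<^sub>1 then B\<^sub>1 else B\<^sub>2)"
      using B1(1) B2(1) by (auto simp: side_def B_def)
    then have "\<not> lin_indep ?I (rig_row x\<^sub>0) (insert e {b \<in> B. side b = side e})"
      using B1(3)[of e] B2(3)[of e] e by (auto simp: B_def)
    then show ?thesis using max[of "insert e {b \<in> B. side b = side e}" x] e BE by blast
  qed
  have fin_copies: "finite (UNIV \<times> V :: (bool \<times> 'v) set)" using fin by simp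
  \<comment> \<open>Competitors live on natural numbers, so two tagged copies of all of
    \<open>V\<close> are encoded there, and \<open>\<pi>\<close> forgets the tag.\<close>
  obtain enc :: "bool \<times> 'v \<Rightarrow> nat" where enc: "inj_on enc (UNIV \<times> V)"
    using finite_imp_inj_to_nat_seg[OF fin_copies] by blast
  define W where "W = enc ` (UNIV \<times> V)"
  define \<iota> where "\<iota> \<sigma> v = enc (\<sigma>, v)" for \<sigma> v
  define \<pi> where "\<pi> n = snd (inv_into (UNIV \<times> V) enc n)" for n
  have "\<exists>p q. alg_indep ?I p \<and> alg_indep (W \<times> {..<d}) q \<and>
    (\<forall>u v. {u, v} \<in> E \<longrightarrow>
      real_sqlen d p u v = real_sqlen d q (\<iota> (side {u, v}) u) (\<iota> (side {u, v}) v))"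
  proof (rule ex_generic_length_equal_pair[where \<pi> = \<pi>, OF G BE _ _ _ _ gen indep dep])
    show "finite W" using fin by (simp add: W_def)
    show "\<pi> (\<iota> \<sigma> v) = v" "\<iota> \<sigma> v \<in> W" if "v \<in> V" for \<sigma> v
      using that enc by (auto simp: \<pi>_def \<iota>_def W_def)
    show "\<pi> n \<in> V" if "n \<in> W" for n
      using that inv_into_into[of n enc "UNIV \<times> V"] by (auto simp: \<pi>_def W_def)
  qed
  then obtain p q where pq: "alg_indep ?I p" "alg_indep (W \<times> {..<d}) q"
    "\<And>u v. {u, v} \<in> E \<Longrightarrow>
      real_sqlen d p u v = real_sqlen d q (\<iota> (side {u, v}) u) (\<iota> (side {u, v}) v)"
    by blast
  obtain v e\<^sub>1 e\<^sub>2 where v: "v \<in> e\<^sub>1" "v \<in> e\<^sub>2" "e\<^sub>1 \<in> E\<^sub>1" "e\<^sub>2 \<in> E - E\<^sub>1" using E\<^sub>1 by blast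
  have EV: "e \<subseteq> V" if "e \<in> E" for e using G that by (simp add: simple_graph_def)
  have img: "\<iota> \<sigma> ` e = enc ` ({\<sigma>} \<times> e)" for \<sigma> e by (auto simp: \<iota>_def)
  have "e\<^sub>1 \<inter> e\<^sub>2 = {} \<longleftrightarrow> \<iota> (side e\<^sub>1) ` e\<^sub>1 \<inter> \<iota> (side e\<^sub>2) ` e\<^sub>2 = {}"
  proof (rule reconstructible_edges_disjoint[OF G rec pq(1,2), where \<iota> = "\<lambda>e. \<iota> (side e)"])
    show "finite W" using fin by (simp add: W_def)
    show "e\<^sub>1 \<in> E" "e\<^sub>2 \<in> E" using v E\<^sub>1 by auto
    show "inj_on (\<lambda>e. \<iota> (side e) ` e) E"
    proof (rule inj_onI)
      fix e e' assume ee: "e \<in> E" "e' \<in> E" and "\<iota> (side e) ` e = \<iota> (side e') ` e'"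
      then have "{side e} \<times> e = {side e'} \<times> e'"
        unfolding img using inj_on_image_eq_iff[OF enc] EV by (metis Sigma_mono UNIV_I subsetI)
      moreover have "e \<noteq> {}" using G ee by (auto simp: simple_graph_def)
      ultimately show "e = e'" by auto
    qed
    show "inj_on (\<iota> (side e)) e" if "e \<in> E" for e
    proof (rule inj_onI)
      fix x y assume "x \<in> e" "y \<in> e" "\<iota> (side e) x = \<iota> (side e) y"
      then show "x = y"
        using inj_onD[OF enc, of "(side e, x)" "(side e, y)"] EV[OF that] by (auto simp: \<iota>_def)
    qed
    show "\<iota> (side e) ` e \<subseteq> W" if "e \<in> E" for e
      using EV[OF that] by (auto simp: \<iota>_def W_def)
  qed (rule pq(3))
  then obtain a b where ab: "a \<in> e\<^sub>1" "b \<in> e\<^sub>2" "enc (True, a) = enc (False, b)"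
    using v by (auto simp: \<iota>_def side_def)
  then have "(True, a) = (False, b)"
    using EV v E\<^sub>1 by (intro inj_onD[OF enc]) auto
  then show False by simp
qed

theorem theorem3p7:
  fixes V :: "'v set" and E :: "'v set set" and d :: nat
  assumes "simple_graph V E"
    and "no_isolated V E"
    and "fully_reconstructible d V E"
  shows "M_connected d V E"
proof (rule ccontr)
  let ?I = "V \<times> {..<d}"
  assume "\<not> M_connected d V E"
  then obtain e f where ef: "e \<in> E" "f \<in> E" "e \<noteq> f"
    and none: "\<And>C. rig_circuit d V E C \<Longrightarrow> e \<in> C \<Longrightarrow> f \<notin> C"
    unfolding M_connected_def by blast
  from ex_point_of_maximal_ranks[OF assms(1)]
  obtain x\<^sub>0 where x0: "alg_indep ?I x\<^sub>0 \<and> (\<forall>S\<subseteq>E. \<forall>x.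
    lin_indep ?I (rig_row x) S \<longrightarrow> lin_indep ?I (rig_row x\<^sub>0) S)" by (rule exE)
  then have gen: "alg_indep ?I x\<^sub>0" by (rule conjunct1)
  have max: "lin_indep ?I (rig_row x\<^sub>0) S" if "S \<subseteq> E" "lin_indep ?I (rig_row x) S" for S x
    by (rule conjunct2[OF x0, rule_format, OF that])
  have indep_iff: "rig_indep d V S \<longleftrightarrow> lin_indep ?I (rig_row x\<^sub>0) S" if "S \<subseteq> E" for S
  proof
    assume "rig_indep d V S"
    then show "lin_indep ?I (rig_row x\<^sub>0) S"
      using max[OF that] unfolding rig_indep_def rows_indep_iff by blast
  next
    assume "lin_indep ?I (rig_row x\<^sub>0) S"
    then have "rows_indep d V (curry x\<^sub>0) S" unfolding rows_indep_iff by (simp add: case_prod_unfold)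
    then show "rig_indep d V S" unfolding rig_indep_def using gen generic_curry by blast
  qed
  have none': "f \<notin> C" if "lin_circuit ?I (rig_row x\<^sub>0) C" "C \<subseteq> E" "e \<in> C" for C
  proof (rule none[OF _ that(3)])
    show "rig_circuit d V E C"
      using that indep_iff unfolding rig_circuit_def lin_circuit_def by auto
  qed
  obtain E\<^sub>1 where E1: "E\<^sub>1 \<subseteq> E" "e \<in> E\<^sub>1" "f \<notin> E\<^sub>1"
    and sep: "\<forall>c. (\<forall>k\<in>?I. (\<Sum>e\<in>E. c e * rig_row x\<^sub>0 e k) = 0) \<longrightarrow>
      (\<forall>k\<in>?I. (\<Sum>e\<in>E\<^sub>1. c e * rig_row x\<^sub>0 e k) = 0)"
    using separation_if_no_common_circuit[of E e f ?I "rig_row x\<^sub>0",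
        OF simple_graph_finite(2)[OF assms(1)] ef none'] by blast
  have "\<Union>E\<^sub>1 \<inter> \<Union>(E - E\<^sub>1) \<noteq> {}"
    using reconstructible_not_disjoint[OF assms(1,3) E1(1)] E1 ef by blast
  then show False
    by (rule reconstructible_not_separable[OF assms(1,3) E1(1) _ gen max]) (use sep in auto)
qed

end
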